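(* For every partition $\mu=(\mu_1,\ldots,\mu_\ell)$, \[ h_\mu=\sum_T \tilde s_{\overline{shape(T)}}, \] where the sum is over all tableaux $T$ (in French notation) of skew shape $\lambda/(\lambda_2)$ for some partition $\lambda$ (i.e. the leftmost $\lambda_2$ cells of the first row are left blank and all other cells of the diagram of $\lambda$ are filled), whose filled cells contain non-empty multisets of positive integers, which are column strict with respect to the total order on multisets described below (weakly increasing from left to right along rows and strictly increasing from bottom to top up columns, among filled cells), and whose total content (multiset union of all entries) is $\{\!\!\{1^{\mu_1},2^{\mu_2},\ldots,\ell^{\mu_\ell}\}\!\!\}$. Here for $\lambda=(\lambda_1,\lambda_2,\ldots)$ with outer shape $shape(T)=\lambda$, $\overline{\lambda}=(\lambda_2,\lambda_3,\ldots)$.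
   Context: Multisets are totally ordered lexicographically as words, after listing the entries of each multiset in increasing order. $Sym=\mathbb{Q}[p_1,p_2,\ldots]$ with standard bases $h_\lambda,s_\lambda$. A multiset partition of a multiset $S$ is a multiset of nonempty multisets with multiset union $S$; $\tilde m(\pi)$ is the partition of multiplicities of the distinct multisets in $\pi$. The basis $\{\tilde h_\lambda\}$ is determined recursively by $h_\lambda=\sum_{\pi}\tilde h_{\tilde m(\pi)}$, the sum over all multiset partitions $\pi$ of $\{\!\!\{1^{\lambda_1},\ldots,\ell(\lambda)^{\lambda_{\ell(\lambda)}}\}\!\!\}$. The irreducible character basis is $\tilde s_\lambda=\sum_{|\mu|\le|\lambda|}K^{-1}_{(n-|\lambda|,\lambda),(n-|\mu|,\mu)}\tilde h_\mu$ for any $n\ge2|\lambda|$ (independent of such $n$), with $K^{-1}$ the inverse Kostka matrix ($s_\alpha=\sum_\beta K^{-1}_{\alpha\beta}h_\beta$). *)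

theory Defs
  imports Complex_Main "HOL-Library.Multiset" "HOL-Library.Function_Algebras"
begin

text \<open>Sym is represented by coordinates in the (algebraic) basis h_lambda:
  an element of Sym is a function from partitions to rat (its h-expansion).\<close>
type_synonym sym = "nat list \<Rightarrow> rat"

definition is_partition :: "nat list \<Rightarrow> bool" where
  "is_partition la \<longleftrightarrow> sorted_wrt (\<ge>) la \<and> (\<forall>x\<in>set la. 0 < x)"

definition partitions_of :: "nat \<Rightarrow> nat list set" where
  "partitions_of n = {la. is_partition la \<and> sum_list la = n}"

definition hbasis :: "nat list \<Rightarrow> sym" where
  "hbasis la = (\<lambda>nu. if nu = la then 1 else 0)"

definition sscale :: "rat \<Rightarrow> sym \<Rightarrow> sym" where
  "sscale c f = (\<lambda>x. c * f x)"

text \<open>Young diagram cells (row i, column j), 0-indexed, French notation: row 0 is the bottom row.\<close>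
definition cells :: "nat list \<Rightarrow> (nat \<times> nat) set" where
  "cells la = {(i, j). i < length la \<and> j < la ! i}"

definition ssyt :: "nat list \<Rightarrow> nat list \<Rightarrow> (nat \<times> nat \<Rightarrow> nat) set" where
  "ssyt la mu = {T. (\<forall>c. c \<notin> cells la \<longrightarrow> T c = 0)
      \<and> (\<forall>c\<in>cells la. 1 \<le> T c \<and> T c \<le> length mu)
      \<and> (\<forall>i j. (i, Suc j) \<in> cells la \<longrightarrow> T (i, j) \<le> T (i, Suc j))
      \<and> (\<forall>i j. (Suc i, j) \<in> cells la \<longrightarrow> T (i, j) < T (Suc i, j))
      \<and> (\<forall>k < length mu. card {c \<in> cells la. T c = Suc k} = mu ! k)}"

definition kostka :: "nat list \<Rightarrow> nat list \<Rightarrow> nat" where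
  "kostka la mu = card (ssyt la mu)"

definition schur_family :: "nat \<Rightarrow> nat list \<Rightarrow> sym" where
  "schur_family n = (THE S.
      (\<forall>mu\<in>partitions_of n.
         hbasis mu = (\<Sum>la\<in>partitions_of n. sscale (of_nat (kostka la mu)) (S la)))
    \<and> (\<forall>la. la \<notin> partitions_of n \<longrightarrow> S la = 0))"

definition schur :: "nat list \<Rightarrow> sym" where
  "schur la = schur_family (sum_list la) la"

text \<open>Inverse Kostka matrix: s_al = sum_be Kinv al be * h_be.\<close>
definition Kinv :: "nat list \<Rightarrow> nat list \<Rightarrow> rat" where
  "Kinv al be = schur al be"

definition mset_partitions :: "nat multiset \<Rightarrow> nat multiset multiset set" where
  "mset_partitions S = {P. (\<forall>B\<in>#P. B \<noteq> {#}) \<and> sum_mset P = S}"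

definition mtilde :: "nat multiset multiset \<Rightarrow> nat list" where
  "mtilde P = rev (sorted_list_of_multiset (image_mset (\<lambda>B. count P B) (mset_set (set_mset P))))"

definition content :: "nat list \<Rightarrow> nat multiset" where
  "content la = (\<Sum>i<length la. replicate_mset (la ! i) (Suc i))"

definition htilde_family :: "nat list \<Rightarrow> sym" where
  "htilde_family = (THE H.
      (\<forall>la. is_partition la \<longrightarrow>
         hbasis la = (\<Sum>P\<in>mset_partitions (content la). H (mtilde P)))
    \<and> (\<forall>la. \<not> is_partition la \<longrightarrow> H la = 0))"

definition htilde :: "nat list \<Rightarrow> sym" where
  "htilde la = htilde_family la"

definition prepend :: "nat \<Rightarrow> nat list \<Rightarrow> nat list" where
  "prepend k la = (if k = 0 then la else k # la)"

definition stilde :: "nat list \<Rightarrow> sym" where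
  "stilde la = (let n = 2 * sum_list la in
     (\<Sum>mu\<in>{mu. is_partition mu \<and> sum_list mu \<le> sum_list la}.
        sscale (Kinv (prepend (n - sum_list la) la) (prepend (n - sum_list mu) mu)) (htilde mu)))"

definition mset_less :: "nat multiset \<Rightarrow> nat multiset \<Rightarrow> bool" where
  "mset_less A B \<longleftrightarrow>
     (sorted_list_of_multiset A, sorted_list_of_multiset B) \<in> lexord {(x, y). x < y}"

definition mset_le :: "nat multiset \<Rightarrow> nat multiset \<Rightarrow> bool" where
  "mset_le A B \<longleftrightarrow> A = B \<or> mset_less A B"

definition second_part :: "nat list \<Rightarrow> nat" where
  "second_part la = (if 2 \<le> length la then la ! 1 else 0)"

definition filled :: "nat list \<Rightarrow> (nat \<times> nat) set" where
  "filled la = cells la - {(0, j) | j. j < second_part la}"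

definition mtableaux :: "nat list \<Rightarrow> (nat list \<times> (nat \<times> nat \<Rightarrow> nat multiset)) set" where
  "mtableaux mu = {(la, T). is_partition la
      \<and> (\<forall>c. c \<notin> filled la \<longrightarrow> T c = {#})
      \<and> (\<forall>c\<in>filled la. T c \<noteq> {#} \<and> (\<forall>x\<in>#T c. 0 < x))
      \<and> (\<forall>i j. (i, j) \<in> filled la \<and> (i, Suc j) \<in> filled la \<longrightarrow> mset_le (T (i, j)) (T (i, Suc j)))
      \<and> (\<forall>i j. (i, j) \<in> filled la \<and> (Suc i, j) \<in> filled la \<longrightarrow> mset_less (T (i, j)) (T (Suc i, j)))
      \<and> (\<Sum>c\<in>filled la. T c) = content mu}"

end

theory Submission
  imports Defs "HOL-Library.List_Lexorder"
begin

text \<open>By the definition of \<open>htilde\<close>, the function \<open>h\<^sub>\<mu>\<close> is the sum over all multiset partitions \<open>P\<close> of the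
  \<open>htilde\<close> indexed by the multiplicities of \<open>P\<close>.  Inverting the definition of \<open>stilde\<close>, the \<open>htilde\<close> of \<open>\<nu>\<close>
  is the combination of the \<open>stilde\<close> of \<open>\<lambda>\<close> whose coefficients are the Kostka numbers of
  \<open>(n - |\<lambda>|, \<lambda>)\<close> and \<open>(n - |\<nu>|, \<nu>)\<close>, which are the same for all large \<open>n\<close>.
  Such a Kostka number counts fillings in which the smallest entry occupies a long initial segment
  of the bottom row; deleting all but \<open>\<lambda>\<^sub>1\<close> of these cells leaves a skew tableau as in the theorem.
  Since Kostka numbers do not depend on the order of the content, the remaining
  entries may be replaced by the blocks of \<open>P\<close> in their lexicographic order.

  Tableaux are counted as chains of shapes differing by horizontal strips, where shapes are
  functions on row indices; a bound \<open>L\<close> on the number of rows makes sizes finite sums.\<close>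

section \<open>Unique solutions of recursive systems\<close>

text \<open>\<open>schur_family\<close> and \<open>htilde_family\<close> are described as unique
  solutions of triangular systems; solving each equation for its diagonal term gives a recursion of
  this form. Well-founded recursion along \<open>r\<close> yields a solution, and induction along
  \<open>r\<close> shows that it is the only one.\<close>

lemma ex1_measure_recursion:
  fixes F :: "('i \<Rightarrow> 'v::zero) \<Rightarrow> 'i \<Rightarrow> 'v" and r :: "'i \<Rightarrow> nat"
  assumes cong: "\<And>S S' i. i \<in> I \<Longrightarrow> (\<And>j. r j < r i \<Longrightarrow> S j = S' j) \<Longrightarrow> F S i = F S' i"
  shows "\<exists>!S. (\<forall>i\<in>I. S i = F S i) \<and> (\<forall>i. i \<notin> I \<longrightarrow> S i = 0)"
proof -
  define G where "G S i = (if i \<in> I then F S i else 0)" for S i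
  define S where "S = wfrec (measure r) G"
  have "adm_wf (measure r) G"
    unfolding adm_wf_def
  proof (intro allI impI)
    fix S S' :: "'i \<Rightarrow> 'v" and i assume "\<forall>z. (z, i) \<in> measure r \<longrightarrow> S z = S' z"
    thus "G S i = G S' i" unfolding G_def using cong[of i S S'] by simp
  qed
  hence "S = G S"
    unfolding S_def by (rule wfrec_fixpoint[OF wf_measure])
  hence SG: "S i = G S i" for i
    by (rule fun_cong)
  have fp: "S i = F S i" if "i \<in> I" for i
    unfolding SG[of i] using that by (simp only: G_def if_True)
  have fp0: "S i = 0" if "i \<notin> I" for i
    unfolding SG[of i] using that by (simp only: G_def if_False)
  show ?thesis
  proof (rule ex1I[of _ S])
    show "(\<forall>i\<in>I. S i = F S i) \<and> (\<forall>i. i \<notin> I \<longrightarrow> S i = 0)"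
      by (intro conjI ballI allI impI fp fp0)
  next
    fix S' assume S': "(\<forall>i\<in>I. S' i = F S' i) \<and> (\<forall>i. i \<notin> I \<longrightarrow> S' i = 0)"
    have "S' i = S i" for i
    proof (induction i rule: measure_induct_rule[of r])
      case (less i)
      show ?case
      proof (cases "i \<in> I")
        case True
        hence "F S' i = F S i" by (rule cong) (rule less)
        moreover have "S' i = F S' i" using True S' by blast
        ultimately show ?thesis by (simp only: fp[OF True, symmetric])
      next
        case False
        thus ?thesis using S' fp0[of i] by simp
      qed
    qed
    thus "S' = S" by blast
  qed
qed

section \<open>Chains of horizontal strips\<close>

text \<open>Interlacing of the row lengths says that the cells between the inner shape
  \<open>ka\<close> and the outer shape \<open>la\<close> have at most one member per column. It
  also forces both shapes to be weakly decreasing.\<close>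

definition hstrip :: "(nat \<Rightarrow> nat) \<Rightarrow> (nat \<Rightarrow> nat) \<Rightarrow> bool" where
  "hstrip ka la \<longleftrightarrow> (\<forall>i. ka i \<le> la i \<and> la (Suc i) \<le> ka i)"

definition strips :: "nat \<Rightarrow> (nat \<Rightarrow> nat) \<Rightarrow> nat \<Rightarrow> (nat \<Rightarrow> nat) set" where
  "strips L la a = {ka. hstrip ka la \<and> sum la {..<L} = sum ka {..<L} + a}"

text \<open>The head of the list is the size of the outermost strip, so a content appears reversed
  wherever it is turned into a chain.\<close>

fun strip_chains :: "nat \<Rightarrow> (nat \<Rightarrow> nat) \<Rightarrow> (nat \<Rightarrow> nat) \<Rightarrow> nat list \<Rightarrow> nat" where
  "strip_chains L rho la [] = (if rho = la then 1 else 0)"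
| "strip_chains L rho la (a # as) = (\<Sum>ka\<in>strips L la a. strip_chains L rho ka as)"

lemma hstrip_le: "hstrip ka la \<Longrightarrow> ka \<le> la"
  by (simp add: hstrip_def le_fun_def)

lemma hstrip_antimono: "hstrip ka la \<Longrightarrow> ka (Suc i) \<le> ka i"
  unfolding hstrip_def by (meson le_trans)

lemma hstrip_vanish: "hstrip ka la \<Longrightarrow> \<forall>i\<ge>L. la i = 0 \<Longrightarrow> \<forall>i\<ge>L. ka i = 0"
  unfolding hstrip_def by (metis le_zero_eq)

lemma finite_below:
  fixes la :: "nat \<Rightarrow> nat"
  assumes "\<forall>i\<ge>L. la i = 0"
  shows "finite {ka. ka \<le> la}"
proof (rule finite_subset)
  show "{ka. ka \<le> la} \<subseteq> {ka. \<forall>i. (i \<in> {..<L} \<longrightarrow> ka i \<in> {..sum la {..<L}}) \<and> (i \<notin> {..<L} \<longrightarrow> ka i = 0)}"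
  proof (intro subsetI CollectI allI conjI impI)
    fix ka i assume "ka \<in> {ka. ka \<le> la}"
    hence le: "ka i \<le> la i" by (simp add: le_fun_def)
    show "ka i \<in> {..sum la {..<L}}" if "i \<in> {..<L}"
    proof -
      have "la i \<le> sum la {..<L}" using that by (intro member_le_sum) auto
      thus ?thesis using le by simp
    qed
    show "ka i = 0" if "i \<notin> {..<L}" using that le assms by auto
  qed
  show "finite {ka. \<forall>i. (i \<in> {..<L} \<longrightarrow> ka i \<in> {..sum la {..<L}}) \<and> (i \<notin> {..<L} \<longrightarrow> ka i = 0)}"
    by (rule finite_set_of_finite_funs) auto
qed

lemma finite_strips: "\<forall>i\<ge>L. la i = 0 \<Longrightarrow> finite (strips L la a)"
  by (rule finite_subset[OF _ finite_below[of L la]]) (auto simp: strips_def dest: hstrip_le)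

text \<open>Each row of the middle shape is constrained by \<open>rho\<close> and \<open>la\<close>
  alone, so the middle shapes form a product of intervals. The bottom row has no row of
  \<open>rho\<close> below it, and there \<open>la 0\<close> is merely repeated as the second upper
  bound.\<close>

lemma interlacing_iff_box:
  "hstrip rho ka \<and> hstrip ka la \<longleftrightarrow>
     (\<forall>i. max (rho i) (la (Suc i)) \<le> ka i \<and> ka i \<le> min (la i) (if i = 0 then la 0 else rho (i - 1)))"
  (is "?l \<longleftrightarrow> ?r")
proof
  assume l: ?l
  show ?r
  proof
    fix i show "max (rho i) (la (Suc i)) \<le> ka i \<and> ka i \<le> min (la i) (if i = 0 then la 0 else rho (i - 1))"
      using l by (cases i) (auto simp: hstrip_def)
  qed
next
  assume r: ?r
  have "ka (Suc i) \<le> rho i" for i using r[rule_format, of "Suc i"] by simp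
  thus ?l using r by (auto simp: hstrip_def)
qed

text \<open>Bender-Knuth symmetry in terms of Gelfand-Tsetlin patterns: the middle row of two
  consecutive horizontal strips ranges over a box, and reflecting this box in its centre
  exchanges the sizes of the strips.\<close>

lemma card_interlacing_swap:
  assumes la: "\<forall>i\<ge>L. la i = 0"
  shows "card {ka \<in> strips L la a. rho \<in> strips L ka b} = card {ka \<in> strips L la b. rho \<in> strips L ka a}"
proof -
  define lo where "lo i = max (rho i) (la (Suc i))" for i
  define hi where "hi i = min (la i) (if i = 0 then la 0 else rho (i - 1))" for i
  have box: "{ka \<in> strips L la a. rho \<in> strips L ka b} =
      {ka. (\<forall>i. lo i \<le> ka i \<and> ka i \<le> hi i) \<and> sum la {..<L} = sum ka {..<L} + a
         \<and> sum ka {..<L} = sum rho {..<L} + b}" for a b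
    using interlacing_iff_box[of rho _ la] unfolding strips_def lo_def hi_def by blast
  \<comment> \<open>Extending the sum of \<open>hi\<close> by its zero term at \<open>L\<close>
    allows a shift by one row; then \<open>max\<close> and \<open>min\<close> of the same two
    numbers pair up and add to the sum of these numbers.\<close>
  have "hi L = 0" using la by (simp add: hi_def)
  hence "sum hi {..<L} = sum hi {..<Suc L}" by simp
  also have "\<dots> = la 0 + (\<Sum>i<L. min (la (Suc i)) (rho i))"
    by (subst sum.lessThan_Suc_shift) (simp add: hi_def)
  finally have "sum lo {..<L} + sum hi {..<L} =
      la 0 + ((\<Sum>i<L. max (rho i) (la (Suc i))) + (\<Sum>i<L. min (la (Suc i)) (rho i)))"
    by (simp add: lo_def)
  also have "(\<Sum>i<L. max (rho i) (la (Suc i))) + (\<Sum>i<L. min (la (Suc i)) (rho i)) =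
      (\<Sum>i<L. rho i + la (Suc i))"
    unfolding sum.distrib[symmetric] by (intro sum.cong) auto
  also have "la 0 + \<dots> = sum rho {..<L} + sum la {..<Suc L}"
    by (subst sum.lessThan_Suc_shift) (simp add: sum.distrib)
  also have "\<dots> = sum rho {..<L} + sum la {..<L}" using la by simp
  finally have tot: "sum lo {..<L} + sum hi {..<L} = sum rho {..<L} + sum la {..<L}" .
  \<comment> \<open>The subtraction is exact on the box because \<open>ka i \<le> hi i\<close>
    there.\<close>
  define R where "R ka i = lo i + hi i - ka i" for ka i
  \<comment> \<open>A shape and its reflection have sizes adding up to those of \<open>rho\<close>
    and \<open>la\<close>, which exchanges the two strip sizes.\<close>
  have Rsum: "sum (R ka) {..<L} + sum ka {..<L} = sum rho {..<L} + sum la {..<L}"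
    if "\<forall>i. lo i \<le> ka i \<and> ka i \<le> hi i" for ka
  proof -
    have "R ka i + ka i = lo i + hi i" for i using that[rule_format, of i] by (simp add: R_def)
    hence "sum (R ka) {..<L} + sum ka {..<L} = (\<Sum>i<L. lo i + hi i)"
      unfolding sum.distrib[symmetric] by simp
    thus ?thesis using tot by (simp add: sum.distrib)
  qed
  have Rbox: "\<forall>i. lo i \<le> R ka i \<and> R ka i \<le> hi i" if "\<forall>i. lo i \<le> ka i \<and> ka i \<le> hi i" for ka
  proof
    fix i show "lo i \<le> R ka i \<and> R ka i \<le> hi i" using that[rule_format, of i] by (auto simp: R_def)
  qed
  have RR: "R (R ka) = ka" if "\<forall>i. lo i \<le> ka i \<and> ka i \<le> hi i" for ka
  proof
    fix i show "R (R ka) i = ka i" using that[rule_format, of i] by (auto simp: R_def)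
  qed
  have "bij_betw R {ka \<in> strips L la a. rho \<in> strips L ka b} {ka \<in> strips L la b. rho \<in> strips L ka a}"
    unfolding box
  proof (rule bij_betw_byWitness[where f' = R])
    have *: "R ` {ka. (\<forall>i. lo i \<le> ka i \<and> ka i \<le> hi i) \<and> sum la {..<L} = sum ka {..<L} + a
        \<and> sum ka {..<L} = sum rho {..<L} + b}
      \<subseteq> {ka. (\<forall>i. lo i \<le> ka i \<and> ka i \<le> hi i) \<and> sum la {..<L} = sum ka {..<L} + b
        \<and> sum ka {..<L} = sum rho {..<L} + a}" for a b
    proof (rule image_subsetI, rule CollectI)
      fix ka assume "ka \<in> {ka. (\<forall>i. lo i \<le> ka i \<and> ka i \<le> hi i) \<and> sum la {..<L} = sum ka {..<L} + a
        \<and> sum ka {..<L} = sum rho {..<L} + b}"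
      hence ka: "\<forall>i. lo i \<le> ka i \<and> ka i \<le> hi i" "sum la {..<L} = sum ka {..<L} + a"
        "sum ka {..<L} = sum rho {..<L} + b" by auto
      show "(\<forall>i. lo i \<le> R ka i \<and> R ka i \<le> hi i) \<and> sum la {..<L} = sum (R ka) {..<L} + b
          \<and> sum (R ka) {..<L} = sum rho {..<L} + a"
        using Rbox[OF ka(1)] Rsum[OF ka(1)] ka(2,3) by auto
    qed
    show "R ` {ka. (\<forall>i. lo i \<le> ka i \<and> ka i \<le> hi i) \<and> sum la {..<L} = sum ka {..<L} + a
        \<and> sum ka {..<L} = sum rho {..<L} + b}
      \<subseteq> {ka. (\<forall>i. lo i \<le> ka i \<and> ka i \<le> hi i) \<and> sum la {..<L} = sum ka {..<L} + b
        \<and> sum ka {..<L} = sum rho {..<L} + a}"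
      "R ` {ka. (\<forall>i. lo i \<le> ka i \<and> ka i \<le> hi i) \<and> sum la {..<L} = sum ka {..<L} + b
        \<and> sum ka {..<L} = sum rho {..<L} + a}
      \<subseteq> {ka. (\<forall>i. lo i \<le> ka i \<and> ka i \<le> hi i) \<and> sum la {..<L} = sum ka {..<L} + a
        \<and> sum ka {..<L} = sum rho {..<L} + b}"
      by (rule *)+
  qed (auto simp: RR)
  thus ?thesis by (rule bij_betw_same_card)
qed

section \<open>Symmetry of chain counts in the strip sizes\<close>

lemma strip_chains_Cons_Cons:
  assumes la: "\<forall>i\<ge>L. la i = 0"
  shows "strip_chains L rho la (a # b # as) =
    (\<Sum>nu\<in>{ka. ka \<le> la}. card {ka \<in> strips L la a. nu \<in> strips L ka b} * strip_chains L rho nu as)"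
proof -
  \<comment> \<open>Summing over all \<open>nu\<close> below \<open>la\<close> gives an index set
    independent of \<open>a\<close> and \<open>b\<close>; only the number of middle shapes then
    depends on their order.\<close>
  have eq: "strips L ka b = {nu \<in> {ka. ka \<le> la}. nu \<in> strips L ka b}" if "ka \<in> strips L la a" for ka
  proof -
    have "nu \<le> la" if "nu \<in> strips L ka b" for nu
      using that \<open>ka \<in> strips L la a\<close> hstrip_le[of nu ka] hstrip_le[of ka la]
      by (simp add: strips_def)
    thus ?thesis by blast
  qed
  have "strip_chains L rho la (a # b # as) =
      (\<Sum>ka\<in>strips L la a. \<Sum>nu\<in>{nu \<in> {ka. ka \<le> la}. nu \<in> strips L ka b}. strip_chains L rho nu as)"
    unfolding strip_chains.simps by (intro sum.cong[OF refl] sum.cong eq refl)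
  also have "\<dots> = (\<Sum>nu\<in>{ka. ka \<le> la}. \<Sum>ka | ka \<in> strips L la a \<and> nu \<in> strips L ka b. strip_chains L rho nu as)"
    by (rule sum.swap_restrict[OF finite_strips[OF la] finite_below[OF la]])
  finally show ?thesis by simp
qed

lemma strip_chains_swap:
  "\<forall>i\<ge>L. la i = 0 \<Longrightarrow> strip_chains L rho la (a # b # as) = strip_chains L rho la (b # a # as)"
  by (subst (1 2) strip_chains_Cons_Cons)
    (auto intro!: sum.cong arg_cong2[of _ _ _ _ "(*)"] card_interlacing_swap)

lemma strip_chains_Cons_cong:
  assumes "\<forall>i\<ge>L. la i = 0"
    and "\<And>ka. \<forall>i\<ge>L. ka i = 0 \<Longrightarrow> strip_chains L rho ka as = strip_chains L rho ka bs"
  shows "strip_chains L rho la (a # as) = strip_chains L rho la (a # bs)"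
  using assms hstrip_vanish[OF _ assms(1)] by (auto simp: strips_def intro!: sum.cong)

text \<open>If the heads differ, the head of \<open>bs\<close> is first moved to second place within
  the tail of \<open>as\<close>, then swapped to the front, after which only tails have to be
  matched. Tails are rearranged before the recursion, hence the induction on the length.\<close>

lemma strip_chains_permute:
  assumes "\<forall>i\<ge>L. la i = 0" "mset as = mset bs"
  shows "strip_chains L rho la as = strip_chains L rho la bs"
  using assms
proof (induction "length as" arbitrary: as bs la)
  case 0
  thus ?case by simp
next
  case (Suc n)
  from Suc.hyps(2) obtain a as' where as: "as = a # as'" by (cases as) auto
  with Suc.prems obtain b bs' where bs: "bs = b # bs'" by (cases bs) auto
  have IH: "strip_chains L rho ka xs = strip_chains L rho ka ys"
    if "length xs = n" "mset xs = mset ys" "\<forall>i\<ge>L. ka i = 0" for ka xs ys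
    using Suc.hyps(1) that by blast
  have len: "length as' = n" "length bs' = n"
    using Suc.hyps(2) as bs mset_eq_length[OF Suc.prems(2)] by auto
  show ?case
  proof (cases "a = b")
    case True
    show ?thesis unfolding as bs True
      using Suc.prems as bs True len by (intro strip_chains_Cons_cong IH) auto
  next
    case False
    have eq: "add_mset a (mset as') = add_mset b (mset bs')" using Suc.prems as bs by simp
    then obtain C where C: "mset as' = add_mset b C" "mset bs' = add_mset a C"
      using False by (auto simp: add_eq_conv_ex)
    obtain cs where cs: "mset cs = C" using ex_mset by blast
    have "strip_chains L rho la (a # as') = strip_chains L rho la (a # b # cs)"
      using Suc.prems C cs len by (intro strip_chains_Cons_cong IH) auto
    also have "\<dots> = strip_chains L rho la (b # a # cs)" by (rule strip_chains_swap[OF Suc.prems(1)])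
    also have "\<dots> = strip_chains L rho la (b # bs')"
    proof (intro strip_chains_Cons_cong IH)
      show "length (a # cs) = n" using len C cs by (metis mset.simps(2) mset_eq_length)
    qed (use Suc.prems C cs in auto)
    finally show ?thesis using as bs by simp
  qed
qed

lemma strip_chains_nonzero_le: "strip_chains L rho la as \<noteq> 0 \<Longrightarrow> rho \<le> la"
proof (induction as arbitrary: la)
  case Nil
  thus ?case by (auto split: if_splits)
next
  case (Cons a as)
  then obtain ka where "ka \<in> strips L la a" "strip_chains L rho ka as \<noteq> 0"
    by (metis strip_chains.simps(2) sum.neutral)
  thus ?case using Cons.IH[of ka] by (auto simp: strips_def dest!: hstrip_le)
qed

section \<open>The innermost strip and the length of the bottom row\<close>

definition row :: "nat \<Rightarrow> nat \<Rightarrow> nat" where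
  "row c = (\<lambda>i. if i = 0 then c else 0)"

text \<open>A horizontal strip over the empty shape is a single row, so the last strip size only
  tells where the remaining chain starts.\<close>

lemma strip_chains_snoc:
  assumes "\<forall>i\<ge>L. la i = 0" "0 < L" "sum la {..<L} = sum_list as + c"
  shows "strip_chains L 0 la (as @ [c]) = strip_chains L (row c) la as"
  using assms
proof (induction as arbitrary: la)
  case Nil
  have "strip_chains L 0 la [c] = (\<Sum>ka\<in>strips L la c. if ka = 0 then 1 else 0)"
    by (auto intro!: sum.cong)
  also have "\<dots> = (if 0 \<in> strips L la c then 1 else 0)"
    using finite_strips[OF Nil(1)] by simp
  also have "0 \<in> strips L la c \<longleftrightarrow> row c = la"
  proof
    assume "0 \<in> strips L la c"
    hence z: "la (Suc i) = 0" for i by (auto simp: strips_def hstrip_def)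
    obtain L' where L': "L = Suc L'" using Nil(2) by (cases L) auto
    have "sum la {..<L} = la 0"
      unfolding L' by (subst sum.lessThan_Suc_shift) (simp add: z)
    moreover have "la i = 0" if "i \<noteq> 0" for i using z[of "i - 1"] that by simp
    ultimately show "row c = la" using Nil(3) by (auto simp: row_def)
  next
    assume "row c = la"
    thus "0 \<in> strips L la c" using Nil(3) by (auto simp: strips_def hstrip_def row_def)
  qed
  finally show ?case by simp
next
  case (Cons a as)
  show ?case unfolding append_Cons strip_chains.simps
  proof (rule sum.cong[OF refl])
    fix ka assume "ka \<in> strips L la a"
    thus "strip_chains L 0 ka (as @ [c]) = strip_chains L (row c) ka as"
      using Cons.prems hstrip_vanish[OF _ Cons.prems(1)] by (intro Cons.IH) (auto simp: strips_def)
  qed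
qed

text \<open>Once every shape of a chain has a bottom row of length at least \<open>c\<close>, and
  \<open>c\<close> is at least the second row, interlacing of the bottom row with the row above is
  automatic. Lengthening all bottom rows by \<open>d\<close> is therefore a bijection of
  chains.\<close>

lemma strip_chains_shift_row:
  assumes "\<forall>i\<ge>L. la i = 0" "0 < L" "la 1 \<le> c"
  shows "strip_chains L (row c) la as = strip_chains L (row (c + d)) (la(0 := la 0 + d)) as"
  using assms
proof (induction as arbitrary: la)
  case Nil
  have "row c i = la i \<longleftrightarrow> row (c + d) i = (la(0 := la 0 + d)) i" for i
    by (simp add: row_def)
  hence "row c = la \<longleftrightarrow> row (c + d) = la(0 := la 0 + d)"
    unfolding fun_eq_iff by blast
  thus ?case by (simp only: strip_chains.simps)
next
  case (Cons a as)
  let ?s = "\<lambda>ka::nat \<Rightarrow> nat. ka(0 := ka 0 + d)"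
  have van: "\<forall>i\<ge>L. ?s la i = 0" using Cons.prems by auto
  obtain L' where L': "L = Suc L'" using Cons.prems(2) by (cases L) auto
  have sum_s: "sum (?s ka) {..<L} = sum ka {..<L} + d" for ka
    unfolding L' by (subst (1 2) sum.lessThan_Suc_shift) simp
  \<comment> \<open>Chains exist only over shapes that contain the inner row, so the two sums may be
    restricted to bottom rows of length at least \<open>c\<close> and \<open>c + d\<close>. On the
    latter, subtracting \<open>d\<close> is exact.\<close>
  have drop: "(\<Sum>ka\<in>strips L la a. strip_chains L (row c) ka as) =
      (\<Sum>ka\<in>{ka \<in> strips L la a. c \<le> ka 0}. strip_chains L (row c) ka as)" if "\<forall>i\<ge>L. la i = 0" for c la
  proof (rule sum.mono_neutral_right)
    show "\<forall>ka\<in>strips L la a - {ka \<in> strips L la a. c \<le> ka 0}. strip_chains L (row c) ka as = 0"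
    proof (rule ballI, rule ccontr)
      fix ka assume ka: "ka \<in> strips L la a - {ka \<in> strips L la a. c \<le> ka 0}" "strip_chains L (row c) ka as \<noteq> 0"
      have "row c 0 \<le> ka 0" using strip_chains_nonzero_le[OF ka(2)] by (simp add: le_fun_def)
      thus False using ka(1) by (simp add: row_def)
    qed
  qed (auto simp: finite_strips[OF that])
  have "(\<Sum>ka\<in>{ka \<in> strips L la a. c \<le> ka 0}. strip_chains L (row c) ka as) =
     (\<Sum>ka\<in>{ka \<in> strips L (?s la) a. c + d \<le> ka 0}. strip_chains L (row (c + d)) ka as)"
  proof (rule sum.reindex_bij_witness[where i = "\<lambda>ka. ka(0 := ka 0 - d)" and j = ?s])
    fix ka assume ka: "ka \<in> {ka \<in> strips L la a. c \<le> ka 0}"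
    show "(?s ka)(0 := ?s ka 0 - d) = ka" by auto
    have st: "hstrip ka la" using ka by (simp add: strips_def)
    have "hstrip (?s ka) (?s la)" unfolding hstrip_def
    proof
      fix i show "?s ka i \<le> ?s la i \<and> ?s la (Suc i) \<le> ?s ka i"
        using st[unfolded hstrip_def, rule_format, of i] by auto
    qed
    thus "?s ka \<in> {ka \<in> strips L (?s la) a. c + d \<le> ka 0}"
      using ka sum_s by (simp add: strips_def)
    have "ka 1 \<le> c" using st Cons.prems(3) unfolding hstrip_def by (meson le_trans)
    thus "strip_chains L (row (c + d)) (?s ka) as = strip_chains L (row c) ka as"
      using Cons.IH[OF hstrip_vanish[OF st Cons.prems(1)] Cons.prems(2)] by metis
  next
    fix ka assume ka: "ka \<in> {ka \<in> strips L (?s la) a. c + d \<le> ka 0}"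
    let ?k = "ka(0 := ka 0 - d)"
    show eq: "?s ?k = ka" using ka by auto
    have st: "hstrip ka (?s la)" using ka by (simp add: strips_def)
    \<comment> \<open>For the bottom row, \<open>la 1 \<le> c \<le> ka 0 - d\<close> supplies the
      interlacing.\<close>
    have "hstrip ?k la" unfolding hstrip_def
    proof
      fix i show "?k i \<le> la i \<and> la (Suc i) \<le> ?k i"
        using st[unfolded hstrip_def, rule_format, of i] ka Cons.prems(3) by (auto split: if_splits)
    qed
    moreover have "sum ka {..<L} = sum ?k {..<L} + d" using sum_s[of ?k] unfolding eq .
    ultimately show "?k \<in> {ka \<in> strips L la a. c \<le> ka 0}"
      using ka sum_s[of la] by (auto simp: strips_def)
  qed
  thus ?case unfolding strip_chains.simps drop[OF Cons.prems(1)] drop[OF van] .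
qed

section \<open>Skew tableaux as chains\<close>

definition skew :: "(nat \<Rightarrow> nat) \<Rightarrow> (nat \<Rightarrow> nat) \<Rightarrow> (nat \<times> nat) set" where
  "skew rho la = {(i, j). rho i \<le> j \<and> j < la i}"

text \<open>The condition \<open>rho \<le> la\<close> makes the shapes visible even without cells:
  for empty content it is what forces \<open>rho = la\<close>, as in the empty chain.\<close>

definition skew_ssyt :: "(nat \<Rightarrow> nat) \<Rightarrow> (nat \<Rightarrow> nat) \<Rightarrow> nat list \<Rightarrow> (nat \<times> nat \<Rightarrow> nat) set" where
  "skew_ssyt rho la al = {T. rho \<le> la
      \<and> (\<forall>c. c \<notin> skew rho la \<longrightarrow> T c = 0)
      \<and> (\<forall>c\<in>skew rho la. 1 \<le> T c \<and> T c \<le> length al)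
      \<and> (\<forall>i j. (i, j) \<in> skew rho la \<and> (i, Suc j) \<in> skew rho la \<longrightarrow> T (i, j) \<le> T (i, Suc j))
      \<and> (\<forall>i j. (i, j) \<in> skew rho la \<and> (Suc i, j) \<in> skew rho la \<longrightarrow> T (i, j) < T (Suc i, j))
      \<and> (\<forall>k < length al. card {c \<in> skew rho la. T c = Suc k} = al ! k)}"

lemma skew_ssyt_outside: "T \<in> skew_ssyt rho la al \<Longrightarrow> c \<notin> skew rho la \<Longrightarrow> T c = 0"
  by (cases c) (simp add: skew_ssyt_def)

lemma skew_Sigma:
  assumes "\<forall>i\<ge>L. la i = 0"
  shows "skew rho la = (SIGMA i:{..<L}. {rho i..<la i})"
proof -
  have "i < L" if "j < la i" for i j using assms that by (metis not_less less_nat_zero_code)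
  thus ?thesis by (auto simp: skew_def)
qed

lemma finite_skew: "\<forall>i\<ge>L. la i = 0 \<Longrightarrow> finite (skew rho la)"
  by (simp add: skew_Sigma)

lemma card_skew:
  assumes "\<forall>i\<ge>L. la i = 0" "rho \<le> la"
  shows "card (skew rho la) + sum rho {..<L} = sum la {..<L}"
proof -
  have "card (skew rho la) + sum rho {..<L} = (\<Sum>i<L. (la i - rho i) + rho i)"
    unfolding skew_Sigma[OF assms(1)] by (simp add: sum.distrib)
  also have "\<dots> = sum la {..<L}" using assms(2) by (intro sum.cong) (auto simp: le_fun_def)
  finally show ?thesis .
qed

lemma skew_inner_inject:
  assumes "skew ka la = skew ka' la" "ka \<le> la" "ka' \<le> la"
  shows "ka = ka'"
proof
  fix i
  have "(i, j) \<in> skew ka la \<longleftrightarrow> (i, j) \<in> skew ka' la" for j using assms(1) by simp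
  hence e: "ka i \<le> j \<and> j < la i \<longleftrightarrow> ka' i \<le> j \<and> j < la i" for j by (simp add: skew_def)
  show "ka i = ka' i"
    using e[of "ka i"] e[of "ka' i"] assms(2,3) by (auto simp: le_fun_def) (metis le_neq_implies_less)+
qed

lemma skew_ssyt_Nil: "skew_ssyt rho la [] = (if rho = la then {\<lambda>_. 0} else {})"
proof -
  have "rho = la" if "T \<in> skew_ssyt rho la []" for T
  proof
    fix i
    have "(i, rho i) \<notin> skew rho la" "rho \<le> la" using that by (auto simp: skew_ssyt_def)
    thus "rho i = la i" by (auto simp: skew_def le_fun_def intro: antisym)
  qed
  moreover have "skew_ssyt la la [] = {\<lambda>_. 0}" by (auto simp: skew_ssyt_def skew_def)
  ultimately show ?thesis by auto
qed

section \<open>Adding and removing the largest entry\<close>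

definition ext_tab :: "nat \<Rightarrow> (nat \<Rightarrow> nat) \<Rightarrow> (nat \<Rightarrow> nat) \<Rightarrow> (nat \<times> nat \<Rightarrow> nat) \<Rightarrow> nat \<times> nat \<Rightarrow> nat" where
  "ext_tab m ka la T = (\<lambda>c. if c \<in> skew ka la then Suc m else T c)"

lemma ext_tab_in_skew_ssyt:
  assumes la: "\<forall>i\<ge>L. la i = 0" and ka: "ka \<in> strips L la a" and T: "T \<in> skew_ssyt rho ka al"
  shows "ext_tab (length al) ka la T \<in> skew_ssyt rho la (al @ [a])"
proof -
  let ?E = "ext_tab (length al) ka la T"
  have kl: "ka i \<le> la i" and lk: "la (Suc i) \<le> ka i" for i using ka by (auto simp: strips_def hstrip_def)
  have rk: "rho i \<le> ka i" for i using T by (auto simp: skew_ssyt_def le_fun_def)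
  have un: "c \<in> skew rho la \<longleftrightarrow> c \<in> skew rho ka \<or> c \<in> skew ka la" for c
    using kl[of "fst c"] rk[of "fst c"] by (cases c) (auto simp: skew_def)
  have dis: "c \<notin> skew ka la" if "c \<in> skew rho ka" for c
    using that by (cases c) (auto simp: skew_def)
  have T0: "T c = 0" if "c \<notin> skew rho ka" for c by (rule skew_ssyt_outside[OF T that])
  have T1: "1 \<le> T c \<and> T c \<le> length al" if "c \<in> skew rho ka" for c using T that by (auto simp: skew_ssyt_def)
  have Tm: "T c \<le> length al" for c using T0 T1 by (cases "c \<in> skew rho ka") auto
  have Trow: "T (i, j) \<le> T (i, Suc j)" if "(i, j) \<in> skew rho ka" "(i, Suc j) \<in> skew rho ka" for i j
    using T that by (auto simp: skew_ssyt_def)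
  have Tcol: "T (i, j) < T (Suc i, j)" if "(i, j) \<in> skew rho ka" "(Suc i, j) \<in> skew rho ka" for i j
    using T that by (auto simp: skew_ssyt_def)
  have Tcard: "card {c \<in> skew rho ka. T c = Suc k} = al ! k" if "k < length al" for k
    using T that by (auto simp: skew_ssyt_def)
  have row: "?E (i, j) \<le> ?E (i, Suc j)" if c: "(i, j) \<in> skew rho la" "(i, Suc j) \<in> skew rho la" for i j
  proof (cases "(i, Suc j) \<in> skew ka la")
    case True
    thus ?thesis using Tm[of "(i, j)"] by (simp add: ext_tab_def)
  next
    case False
    hence "(i, Suc j) \<in> skew rho ka" using un c by blast
    moreover from this have "(i, j) \<in> skew rho ka" using c(1) by (simp add: skew_def)
    ultimately show ?thesis using Trow dis by (simp add: ext_tab_def)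
  qed
  have col: "?E (i, j) < ?E (Suc i, j)" if c: "(i, j) \<in> skew rho la" "(Suc i, j) \<in> skew rho la" for i j
  proof -
    \<comment> \<open>By interlacing, a cell with a cell of the shape above it lies inside
      \<open>ka\<close>, so the new largest entry never has anything above it.\<close>
    have ij: "(i, j) \<in> skew rho ka" using c lk[of i] by (simp add: skew_def)
    show ?thesis
    proof (cases "(Suc i, j) \<in> skew ka la")
      case True
      thus ?thesis using ij dis Tm[of "(i, j)"] by (simp add: ext_tab_def)
    next
      case False
      hence "(Suc i, j) \<in> skew rho ka" using un c by blast
      thus ?thesis using Tcol[OF ij] ij dis by (simp add: ext_tab_def)
    qed
  qed
  have cnt: "card {c \<in> skew rho la. ?E c = Suc k} = (al @ [a]) ! k" if "k < length (al @ [a])" for k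
  proof (cases "k < length al")
    case True
    have "{c \<in> skew rho la. ?E c = Suc k} = {c \<in> skew rho ka. T c = Suc k}"
      using un dis True by (auto simp: ext_tab_def)
    thus ?thesis using Tcard True by (simp add: nth_append)
  next
    case False
    hence k: "k = length al" using that by simp
    have "{c \<in> skew rho la. ?E c = Suc k} = skew ka la"
      using un Tm k by (auto simp: ext_tab_def) (metis Suc_n_not_le_n)+
    moreover have "card (skew ka la) = a"
      using card_skew[OF la, of ka] ka by (auto simp: strips_def dest: hstrip_le)
    ultimately show ?thesis using k by simp
  qed
  have "rho \<le> la" using rk kl by (auto simp: le_fun_def intro: order_trans)
  moreover have "\<forall>c. c \<notin> skew rho la \<longrightarrow> ?E c = 0" using un T0 by (auto simp: ext_tab_def)
  moreover have "\<forall>c\<in>skew rho la. 1 \<le> ?E c \<and> ?E c \<le> length (al @ [a])"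
    using un T1 by (fastforce simp: ext_tab_def)
  ultimately show ?thesis unfolding skew_ssyt_def using row col cnt by blast
qed

text \<open>By the row condition the largest entries end each row, and by the column condition no
  two of them share a column; so they form a horizontal strip that can be removed.\<close>

lemma skew_ssyt_snoc_decompose:
  assumes la: "\<forall>i\<ge>L. la i = 0" and rho_anti: "\<And>i. rho (Suc i) \<le> rho i" and la_anti: "\<And>i. la (Suc i) \<le> la i"
    and T: "T \<in> skew_ssyt rho la (al @ [a])"
  obtains ka T' where "ka \<in> strips L la a" "T' \<in> skew_ssyt rho ka al" "T = ext_tab (length al) ka la T'"
proof -
  let ?m = "length al"
  have rl: "rho i \<le> la i" for i using T by (auto simp: skew_ssyt_def le_fun_def)
  have T0: "T c = 0" if "c \<notin> skew rho la" for c by (rule skew_ssyt_outside[OF T that])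
  have T1: "1 \<le> T c \<and> T c \<le> Suc ?m" if "c \<in> skew rho la" for c using T that by (auto simp: skew_ssyt_def)
  have Trow: "T (i, j) \<le> T (i, Suc j)" if "(i, j) \<in> skew rho la" "(i, Suc j) \<in> skew rho la" for i j
    using T that by (auto simp: skew_ssyt_def)
  have Tcol: "T (i, j) < T (Suc i, j)" if "(i, j) \<in> skew rho la" "(Suc i, j) \<in> skew rho la" for i j
    using T that by (auto simp: skew_ssyt_def)
  have Tcard: "card {c \<in> skew rho la. T c = Suc k} = (al @ [a]) ! k" if "k < Suc ?m" for k
    using T that by (auto simp: skew_ssyt_def)
  \<comment> \<open>\<open>ka i\<close> is to be the column where the largest entries of row
    \<open>i\<close> begin. The implication makes \<open>la i\<close> admissible, so a row without
    such entries gets \<open>ka i = la i\<close>.\<close>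
  define Q where "Q i j \<longleftrightarrow> rho i \<le> j \<and> (j < la i \<longrightarrow> ?m < T (i, j))" for i j
  define ka where "ka i = (LEAST j. Q i j)" for i
  have "Q i (la i)" for i using rl by (simp add: Q_def)
  hence Qka: "Q i (ka i)" and kl: "ka i \<le> la i" for i
    unfolding ka_def by (rule LeastI, rule Least_le)
  have rk: "rho i \<le> ka i" for i using Qka by (simp add: Q_def)
  have below: "T (i, j) \<le> ?m" if "rho i \<le> j" "j < ka i" for i j
    using not_less_Least[of j "Q i"] that by (auto simp: ka_def Q_def)
  have above: "T (i, j) = Suc ?m" if "ka i \<le> j" "j < la i" for i j
    using that
  proof (induction j rule: dec_induct)
    case base
    have "?m < T (i, ka i)" using Qka[of i] base by (simp add: Q_def)
    thus ?case using T1[of "(i, ka i)"] base rk by (simp add: skew_def)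
  next
    case (step j)
    have "T (i, j) \<le> T (i, Suc j)" using step rk[of i] by (intro Trow) (auto simp: skew_def)
    moreover have "T (i, Suc j) \<le> Suc ?m" using step rk[of i] T1[of "(i, Suc j)"] by (auto simp: skew_def)
    ultimately show ?case using step by simp
  qed
  have un: "c \<in> skew rho la \<longleftrightarrow> c \<in> skew rho ka \<or> c \<in> skew ka la" for c
    using kl[of "fst c"] rk[of "fst c"] by (cases c) (auto simp: skew_def)
  have dis: "c \<notin> skew ka la" if "c \<in> skew rho ka" for c
    using that by (cases c) (auto simp: skew_def)
  have lo: "T c \<le> ?m" if "c \<in> skew rho ka" for c using that below by (cases c) (auto simp: skew_def)
  have up: "T c = Suc ?m" if "c \<in> skew ka la" for c using that above by (cases c) (auto simp: skew_def)
  define T' where "T' c = (if c \<in> skew ka la then 0 else T c)" for c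
  have T': "T' c = T c" if "c \<in> skew rho ka" for c using dis that by (simp add: T'_def)
  \<comment> \<open>Otherwise column \<open>ka i\<close> would carry the largest entry in row
    \<open>i\<close> with another cell above it, against column strictness.\<close>
  have strip: "la (Suc i) \<le> ka i" for i
  proof (rule ccontr)
    assume "\<not> la (Suc i) \<le> ka i"
    hence lt: "ka i < la (Suc i)" by simp
    have c: "(i, ka i) \<in> skew rho la" "(Suc i, ka i) \<in> skew rho la"
      using lt rk[of i] rho_anti[of i] la_anti[of i] by (auto simp: skew_def)
    have "T (i, ka i) = Suc ?m" using lt la_anti[of i] by (intro above) auto
    thus False using Tcol[OF c] T1[OF c(2)] by simp
  qed
  have hs: "hstrip ka la" using kl strip by (simp add: hstrip_def)
  have "{c \<in> skew rho la. T c = Suc ?m} = skew ka la"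
    using un lo up by (auto dest!: lo)
  hence "card (skew ka la) = a" using Tcard[of ?m] by simp
  hence "ka \<in> strips L la a"
    using card_skew[OF la hstrip_le[OF hs]] hs by (simp add: strips_def)
  moreover have "T' \<in> skew_ssyt rho ka al"
  proof -
    have "rho \<le> ka" using rk by (simp add: le_fun_def)
    moreover have "\<forall>c. c \<notin> skew rho ka \<longrightarrow> T' c = 0" using un T0 by (auto simp: T'_def)
    moreover have "\<forall>c\<in>skew rho ka. 1 \<le> T' c \<and> T' c \<le> ?m" using lo T1 T' un by auto
    moreover have "\<forall>i j. (i, j) \<in> skew rho ka \<and> (i, Suc j) \<in> skew rho ka \<longrightarrow> T' (i, j) \<le> T' (i, Suc j)"
      using Trow T' un by auto
    moreover have "\<forall>i j. (i, j) \<in> skew rho ka \<and> (Suc i, j) \<in> skew rho ka \<longrightarrow> T' (i, j) < T' (Suc i, j)"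
      using Tcol T' un by auto
    moreover have "card {c \<in> skew rho ka. T' c = Suc k} = al ! k" if "k < ?m" for k
    proof -
      have "{c \<in> skew rho ka. T' c = Suc k} = {c \<in> skew rho la. T c = Suc k}"
        using un up T' that by auto
      thus ?thesis using Tcard[of k] that by (simp add: nth_append)
    qed
    ultimately show ?thesis unfolding skew_ssyt_def by blast
  qed
  moreover have "T = ext_tab ?m ka la T'"
    using up by (auto simp: ext_tab_def T'_def)
  ultimately show ?thesis by (rule that)
qed

lemma skew_ssyt_snoc:
  assumes "\<forall>i\<ge>L. la i = 0" "\<And>i. rho (Suc i) \<le> rho i" "\<And>i. la (Suc i) \<le> la i"
  shows "skew_ssyt rho la (al @ [a]) =
    (\<Union>ka\<in>strips L la a. ext_tab (length al) ka la ` skew_ssyt rho ka al)"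
proof (intro equalityI subsetI)
  fix T assume "T \<in> skew_ssyt rho la (al @ [a])"
  from skew_ssyt_snoc_decompose[OF assms this]
  show "T \<in> (\<Union>ka\<in>strips L la a. ext_tab (length al) ka la ` skew_ssyt rho ka al)" by blast
qed (auto intro: ext_tab_in_skew_ssyt[OF assms(1)])

lemma ext_tab_inj_on: "inj_on (ext_tab m ka la) (skew_ssyt rho ka al)"
proof (rule inj_onI, rule ext)
  fix T T' c
  assume T: "T \<in> skew_ssyt rho ka al" "T' \<in> skew_ssyt rho ka al" and eq: "ext_tab m ka la T = ext_tab m ka la T'"
  show "T c = T' c"
  proof (cases "c \<in> skew ka la")
    case True
    hence "c \<notin> skew rho ka" by (cases c) (auto simp: skew_def)
    thus ?thesis using T by (simp add: skew_ssyt_outside)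
  next
    case False
    thus ?thesis using fun_cong[OF eq, of c] by (simp add: ext_tab_def)
  qed
qed

text \<open>The new label marks exactly the added strip, so the extended tableau determines
  \<open>ka\<close>; this keeps the pieces in the count below disjoint.\<close>

lemma ext_tab_eq_Suc_iff:
  assumes "T \<in> skew_ssyt rho ka al"
  shows "ext_tab (length al) ka la T c = Suc (length al) \<longleftrightarrow> c \<in> skew ka la"
proof -
  have "T c \<le> length al"
    using assms by (cases "c \<in> skew rho ka") (simp_all add: skew_ssyt_outside, simp add: skew_ssyt_def)
  thus ?thesis by (auto simp: ext_tab_def)
qed

text \<open>Tableaux are sorted by the shape left after removing the largest entry, which is one
  step of the recursion for \<open>strip_chains\<close>.\<close>

lemma skew_ssyt_count:
  assumes "\<forall>i\<ge>L. la i = 0" "\<And>i. rho (Suc i) \<le> rho i" "\<And>i. la (Suc i) \<le> la i"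
  shows "finite (skew_ssyt rho la al) \<and> card (skew_ssyt rho la al) = strip_chains L rho la (rev al)"
  using assms(1,3)
proof (induction al arbitrary: la rule: rev_induct)
  case Nil
  show ?case by (simp add: skew_ssyt_Nil)
next
  case (snoc a al)
  let ?X = "\<lambda>ka. ext_tab (length al) ka la ` skew_ssyt rho ka al"
  have IH: "finite (skew_ssyt rho ka al)" "card (skew_ssyt rho ka al) = strip_chains L rho ka (rev al)"
    if "ka \<in> strips L la a" for ka
    using snoc.IH[of ka] that hstrip_vanish[OF _ snoc.prems(1)] hstrip_antimono
    by (auto simp: strips_def)
  have eq: "skew_ssyt rho la (al @ [a]) = (\<Union>ka\<in>strips L la a. ?X ka)"
    by (rule skew_ssyt_snoc) (use snoc.prems assms(2) in auto)
  have disj: "?X ka \<inter> ?X ka' = {}" if "ka \<in> strips L la a" "ka' \<in> strips L la a" "ka \<noteq> ka'" for ka ka'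
  proof (rule ccontr)
    assume "?X ka \<inter> ?X ka' \<noteq> {}"
    then obtain T T' where T: "T \<in> skew_ssyt rho ka al" "T' \<in> skew_ssyt rho ka' al"
      "ext_tab (length al) ka la T = ext_tab (length al) ka' la T'" by auto
    have "skew ka la = skew ka' la"
      using ext_tab_eq_Suc_iff[OF T(1), of la] ext_tab_eq_Suc_iff[OF T(2), of la] T(3) by auto
    thus False using skew_inner_inject that hstrip_le by (auto simp: strips_def)
  qed
  have fin: "finite (strips L la a)" by (rule finite_strips[OF snoc.prems(1)])
  have "card (\<Union>ka\<in>strips L la a. ?X ka) = (\<Sum>ka\<in>strips L la a. card (?X ka))"
    using fin IH disj by (intro card_UN_disjoint) auto
  also have "\<dots> = (\<Sum>ka\<in>strips L la a. strip_chains L rho ka (rev al))"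
    by (intro sum.cong refl) (simp add: card_image[OF ext_tab_inj_on] IH)
  finally show ?case unfolding eq using fin IH by simp
qed

section \<open>Kostka numbers and Schur functions\<close>

definition parts :: "nat list \<Rightarrow> nat \<Rightarrow> nat" where
  "parts la i = (if i < length la then la ! i else 0)"

lemma parts_simps [simp]: "parts [] i = 0" "parts (a # la) 0 = a" "parts (a # la) (Suc i) = parts la i"
  by (auto simp: parts_def)

lemma parts_vanish: "length la \<le> L \<Longrightarrow> \<forall>i\<ge>L. parts la i = 0"
  by (simp add: parts_def)

lemma parts_antimono: "is_partition la \<Longrightarrow> parts la (Suc i) \<le> parts la i"
  using sorted_wrt_nth_less[of "(\<ge>)" la i "Suc i"] by (simp add: parts_def is_partition_def)

lemma sum_parts:
  assumes "length la \<le> L"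
  shows "sum (parts la) {..<L} = sum_list la"
proof -
  have "sum (parts la) {..<L} = sum (parts la) {..<length la}"
    using assms by (intro sum.mono_neutral_right) (auto simp: parts_def)
  also have "\<dots> = sum_list la"
    by (simp add: parts_def sum_list_sum_nth atLeast0LessThan)
  finally show ?thesis .
qed

lemma parts_0_le_sum_list: "parts la 0 \<le> sum_list la"
  by (cases la) auto

lemma cells_eq_skew: "cells la = skew 0 (parts la)"
  by (auto simp: cells_def skew_def parts_def split: if_splits)

lemma finite_cells: "finite (cells la)"
  unfolding cells_eq_skew by (rule finite_skew[OF parts_vanish[OF order_refl]])

lemma cells_below: "is_partition la \<Longrightarrow> (Suc i, j) \<in> cells la \<Longrightarrow> (i, j) \<in> cells la"
  using parts_antimono[of la i] by (auto simp: cells_eq_skew skew_def)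

lemma ssyt_eq_skew_ssyt:
  assumes "is_partition la"
  shows "ssyt la mu = skew_ssyt 0 (parts la) mu"
proof -
  have row: "(i, j) \<in> skew 0 (parts la) \<and> (i, Suc j) \<in> skew 0 (parts la) \<longleftrightarrow> (i, Suc j) \<in> skew 0 (parts la)" for i j
    by (auto simp: skew_def)
  have col: "(i, j) \<in> skew 0 (parts la) \<and> (Suc i, j) \<in> skew 0 (parts la) \<longleftrightarrow> (Suc i, j) \<in> skew 0 (parts la)" for i j
    using cells_below[OF assms] unfolding cells_eq_skew by blast
  have "0 \<le> parts la" by (simp add: le_fun_def)
  thus ?thesis
    unfolding ssyt_def skew_ssyt_def cells_eq_skew by (simp only: row col simp_thms)
qed

lemma kostka_eq_strip_chains:
  assumes "is_partition la" "length la \<le> L"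
  shows "kostka la mu = strip_chains L 0 (parts la) (rev mu)"
  unfolding kostka_def ssyt_eq_skew_ssyt[OF assms(1)]
  using skew_ssyt_count[of L "parts la" 0 mu] parts_vanish[OF assms(2)] parts_antimono[OF assms(1)] by simp

text \<open>Entries in row \<open>i\<close> are at least \<open>i + 1\<close>, so the sum of the entries of a tableau of shape \<open>\<gamma>\<close> and
  content \<open>\<beta>\<close>, which is the weight of \<open>\<beta>\<close>, is at least the weight of \<open>\<gamma>\<close>; this replaces dominance order.\<close>

definition row_weight :: "nat list \<Rightarrow> nat" where
  "row_weight la = (\<Sum>c\<in>cells la. Suc (fst c))"

lemma card_cells_row: "card {c \<in> cells la. fst c = k} = parts la k"
proof -
  have "{c \<in> cells la. fst c = k} = {k} \<times> {..<parts la k}"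
    by (auto simp: cells_eq_skew skew_def)
  thus ?thesis by (simp add: card_cartesian_product)
qed

lemma ssyt_row_le:
  assumes "is_partition ga" "T \<in> ssyt ga be" "(i, j) \<in> cells ga"
  shows "Suc i \<le> T (i, j)"
  using assms(3)
proof (induction i)
  case 0
  thus ?case using assms(2) by (force simp: ssyt_def)
next
  case (Suc i)
  have "Suc i \<le> T (i, j)" using Suc.IH cells_below[OF assms(1) Suc.prems] by blast
  also have "\<dots> < T (Suc i, j)" using assms(2) Suc.prems by (simp add: ssyt_def)
  finally show ?case by simp
qed

lemma sum_ssyt:
  assumes "T \<in> ssyt ga be"
  shows "(\<Sum>c\<in>cells ga. T c) = row_weight be"
proof -
  have T1: "1 \<le> T c" "T c \<le> length be" if "c \<in> cells ga" for c
    using assms that by (auto simp: ssyt_def)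
  \<comment> \<open>Entries start at 1 while positions of \<open>be\<close> start at 0, hence the
    grouping by \<open>T c - 1\<close>.\<close>
  have "(\<Sum>c\<in>cells ga. T c) = (\<Sum>k<length be. \<Sum>c\<in>{c \<in> cells ga. T c - 1 = k}. T c)"
    using T1 finite_cells by (intro sum.group[symmetric]) fastforce+
  also have "\<dots> = (\<Sum>k<length be. Suc k * be ! k)"
  proof (intro sum.cong refl)
    fix k assume k: "k \<in> {..<length be}"
    have "{c \<in> cells ga. T c - 1 = k} = {c \<in> cells ga. T c = Suc k}"
      using T1 by force
    hence "(\<Sum>c\<in>{c \<in> cells ga. T c - 1 = k}. T c) = (\<Sum>c\<in>{c \<in> cells ga. T c = Suc k}. Suc k)"
      by (auto intro: sum.cong)
    also have "\<dots> = Suc k * card {c \<in> cells ga. T c = Suc k}" by simp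
    also have "card {c \<in> cells ga. T c = Suc k} = be ! k" using assms k by (simp add: ssyt_def)
    finally show "(\<Sum>c\<in>{c \<in> cells ga. T c - 1 = k}. T c) = Suc k * be ! k" .
  qed
  also have "\<dots> = row_weight be"
  proof -
    have "cells be = (SIGMA i:{..<length be}. {..<be ! i})" by (auto simp: cells_def)
    hence "row_weight be = (\<Sum>(i, j)\<in>(SIGMA i:{..<length be}. {..<be ! i}). Suc i)"
      by (simp add: row_weight_def split_def)
    also have "\<dots> = (\<Sum>i<length be. \<Sum>j<be ! i. Suc i)"
      by (intro sum.Sigma[symmetric]) auto
    finally show ?thesis by (simp add: mult.commute)
  qed
  finally show ?thesis .
qed

lemma row_weight_le:
  assumes "is_partition ga" "T \<in> ssyt ga be"
  shows "row_weight ga \<le> row_weight be"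
proof -
  have "row_weight ga \<le> (\<Sum>c\<in>cells ga. T c)"
    unfolding row_weight_def using ssyt_row_le[OF assms] by (intro sum_mono) auto
  thus ?thesis using sum_ssyt[OF assms(2)] by simp
qed

text \<open>Equal totals turn the cellwise bound \<open>ssyt_row_le\<close> into equality in every
  cell.\<close>

lemma ssyt_superstandard:
  assumes "is_partition ga" "T \<in> ssyt ga be" "row_weight ga = row_weight be" "c \<in> cells ga"
  shows "T c = Suc (fst c)"
proof -
  have "(\<Sum>c\<in>cells ga. Suc (fst c)) = (\<Sum>c\<in>cells ga. T c)"
    using sum_ssyt[OF assms(2)] assms(3) by (simp add: row_weight_def)
  from sum_mono_inv[OF this _ assms(4) finite_cells] show ?thesis
    using ssyt_row_le[OF assms(1,2)] by (metis prod.collapse)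
qed

text \<open>In the superstandard tableau the entries \<open>k + 1\<close> are exactly row
  \<open>k\<close>, so content and shape agree; positivity of the parts excludes a difference by
  trailing zeros.\<close>

lemma ssyt_row_weight_eq_imp_eq:
  assumes ga: "is_partition ga" and be: "is_partition be" and T: "T \<in> ssyt ga be"
    and eq: "row_weight ga = row_weight be"
  shows "ga = be"
proof -
  note sup = ssyt_superstandard[OF ga T eq]
  have be_k: "be ! k = parts ga k" if "k < length be" for k
  proof -
    have "be ! k = card {c \<in> cells ga. T c = Suc k}" using T that by (simp add: ssyt_def)
    also have "{c \<in> cells ga. T c = Suc k} = {c \<in> cells ga. fst c = k}" using sup by auto
    finally show ?thesis by (simp add: card_cells_row)
  qed
  have "k < length be" if "k < length ga" for k
  proof -
    have c: "(k, 0) \<in> cells ga" using that ga by (auto simp: cells_def is_partition_def)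
    have "T (k, 0) \<le> length be" using T c by (simp add: ssyt_def)
    thus ?thesis using sup[OF c] by simp
  qed
  moreover have "k < length ga" if "k < length be" for k
  proof -
    have "0 < be ! k" using be that by (auto simp: is_partition_def)
    thus ?thesis using be_k[OF that] by (auto simp: parts_def split: if_splits)
  qed
  ultimately have len: "length ga = length be" by (meson less_irrefl_nat nat_neq_iff)
  show ?thesis using len be_k by (intro nth_equalityI) (auto simp: parts_def)
qed

text \<open>Together with \<open>kostka_refl\<close> this makes the Kostka matrix unitriangular,
  with \<open>row_weight\<close> as the measure along which it is inverted.\<close>

lemma kostka_triangular:
  assumes "is_partition ga" "is_partition be" "kostka ga be \<noteq> 0" "ga \<noteq> be"
  shows "row_weight ga < row_weight be"
proof -
  obtain T where T: "T \<in> ssyt ga be" using assms(3) by (fastforce simp: kostka_def)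
  show ?thesis
    using row_weight_le[OF assms(1) T] ssyt_row_weight_eq_imp_eq[OF assms(1,2) T] assms(4) by linarith
qed

lemma kostka_refl:
  assumes "is_partition be"
  shows "kostka be be = 1"
proof -
  \<comment> \<open>The superstandard filling; by the equality case of the weight bound it is the
    only candidate.\<close>
  define T0 where "T0 c = (if c \<in> cells be then Suc (fst c) else 0)" for c
  have "T = T0" if "T \<in> ssyt be be" for T
  proof
    fix c show "T c = T0 c"
      using ssyt_superstandard[OF assms that refl, of c] that
      by (cases c) (auto simp: T0_def ssyt_def)
  qed
  moreover have "T0 \<in> ssyt be be"
  proof -
    have "card {c \<in> cells be. T0 c = Suc k} = be ! k" if "k < length be" for k
    proof -
      have "{c \<in> cells be. T0 c = Suc k} = {c \<in> cells be. fst c = k}" by (auto simp: T0_def)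
      thus ?thesis using that by (simp add: card_cells_row parts_def)
    qed
    moreover have "(i, j) \<in> cells be" if "(i, Suc j) \<in> cells be" for i j
      using that by (auto simp: cells_def)
    ultimately show ?thesis
      using cells_below[OF assms] unfolding ssyt_def T0_def by (auto simp: cells_def)
  qed
  ultimately have "ssyt be be = {T0}" by blast
  thus ?thesis by (simp add: kostka_def)
qed

text \<open>Entries 1 can only stand in the bottom row.\<close>

lemma kostka_nonzero_first_part:
  assumes "is_partition ga" "kostka ga be \<noteq> 0"
  shows "parts be 0 \<le> parts ga 0"
proof (cases be)
  case (Cons b be')
  obtain T where T: "T \<in> ssyt ga be" using assms(2) by (fastforce simp: kostka_def)
  have "b = card {c \<in> cells ga. T c = Suc 0}" using T Cons by (auto simp: ssyt_def)
  also have "\<dots> \<le> card {c \<in> cells ga. fst c = 0}"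
    using ssyt_row_le[OF assms(1) T] finite_cells by (intro card_mono) fastforce+
  finally show ?thesis using Cons by (simp add: card_cells_row)
qed simp

section \<open>Existence and support of Schur functions\<close>

lemma finite_partitions_le: "finite {la. is_partition la \<and> sum_list la \<le> n}"
proof (rule finite_subset)
  show "{la. is_partition la \<and> sum_list la \<le> n} \<subseteq> {xs. set xs \<subseteq> {..n} \<and> length xs \<le> n}"
  proof (intro subsetI CollectI conjI)
    fix la x assume la: "la \<in> {la. is_partition la \<and> sum_list la \<le> n}"
    show "x \<in> {..n}" if "x \<in> set la" using la member_le_sum_list[of x la] that by auto
    have "length la \<le> sum_list la" if "\<forall>x\<in>set la. 0 < x" using that by (induction la) auto
    thus "length la \<le> n" using la by (auto simp: is_partition_def)
  qed
qed (rule finite_lists_length_le, simp)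

lemma finite_partitions_of: "finite (partitions_of n)"
  by (rule finite_subset[OF _ finite_partitions_le[of n]]) (auto simp: partitions_of_def)

lemma sum_fun_apply: "(\<Sum>i\<in>A. f i) x = (\<Sum>i\<in>A. f i x)" for f :: "'i \<Rightarrow> 'a \<Rightarrow> rat"
  by (induction A rule: infinite_finite_induct) auto

lemma sscale_simps [simp]: "sscale 0 f = 0" "sscale 1 f = f"
  by (auto simp: sscale_def)

text \<open>The diagonal coefficient is 1 and every other nonzero one belongs to a shape of smaller
  \<open>row_weight\<close>, so each equation can be solved for \<open>S mu\<close>.\<close>

lemma schur_family_exists_unique:
  "\<exists>!S. (\<forall>mu\<in>partitions_of n.
         hbasis mu = (\<Sum>la\<in>partitions_of n. sscale (of_nat (kostka la mu)) (S la)))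
    \<and> (\<forall>la. la \<notin> partitions_of n \<longrightarrow> S la = 0)"
proof -
  let ?F = "\<lambda>S mu. hbasis mu - (\<Sum>la\<in>partitions_of n - {mu}. sscale (of_nat (kostka la mu)) (S la))"
  have ex1: "\<exists>!S. (\<forall>mu\<in>partitions_of n. S mu = ?F S mu) \<and> (\<forall>mu. mu \<notin> partitions_of n \<longrightarrow> S mu = 0)"
  proof (rule ex1_measure_recursion[where r = row_weight])
    fix S S' :: "nat list \<Rightarrow> sym" and mu
    assume mu: "mu \<in> partitions_of n" and eq: "\<And>la. row_weight la < row_weight mu \<Longrightarrow> S la = S' la"
    have "sscale (of_nat (kostka la mu)) (S la) = sscale (of_nat (kostka la mu)) (S' la)"
      if la: "la \<in> partitions_of n - {mu}" for la
    proof (cases "kostka la mu = 0")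
      case False
      hence "row_weight la < row_weight mu"
        using la mu by (intro kostka_triangular) (auto simp: partitions_of_def)
      thus ?thesis using eq by simp
    qed simp
    thus "?F S mu = ?F S' mu" by simp
  qed
  have "hbasis mu = (\<Sum>la\<in>partitions_of n. sscale (of_nat (kostka la mu)) (S la)) \<longleftrightarrow> S mu = ?F S mu"
    if "mu \<in> partitions_of n" for mu S
  proof -
    have "(\<Sum>la\<in>partitions_of n. sscale (of_nat (kostka la mu)) (S la)) =
      S mu + (\<Sum>la\<in>partitions_of n - {mu}. sscale (of_nat (kostka la mu)) (S la))"
      using kostka_refl[of mu] that[unfolded partitions_of_def]
      by (simp add: sum.remove[OF finite_partitions_of that])
    thus ?thesis by (simp only: eq_diff_eq) (rule eq_commute)
  qed
  hence eq: "(\<forall>mu\<in>partitions_of n. hbasis mu = (\<Sum>la\<in>partitions_of n. sscale (of_nat (kostka la mu)) (S la))) \<longleftrightarrow>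
      (\<forall>mu\<in>partitions_of n. S mu = ?F S mu)" for S
    by (intro ball_cong refl)
  show ?thesis unfolding eq by (rule ex1)
qed

lemma hbasis_eq_sum_schur_family:
  assumes "mu \<in> partitions_of n"
  shows "hbasis mu = (\<Sum>la\<in>partitions_of n. sscale (of_nat (kostka la mu)) (schur_family n la))"
  using theI'[OF schur_family_exists_unique[of n]] assms unfolding schur_family_def by blast

text \<open>Needed to truncate sums over all partitions of \<open>n\<close>. In the recursion for
  \<open>ga\<close> only shapes with a first part at least that of \<open>ga\<close> occur, so the
  bound passes through the induction.\<close>

lemma schur_family_support:
  assumes "ga \<in> partitions_of n" "schur_family n ga be \<noteq> 0"
  shows "parts ga 0 \<le> parts be 0"
  using assms
proof (induction ga rule: measure_induct_rule[of row_weight])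
  case (less ga)
  have pa: "is_partition ga" using less.prems(1) by (simp add: partitions_of_def)
  have "hbasis ga = schur_family n ga +
      (\<Sum>la\<in>partitions_of n - {ga}. sscale (of_nat (kostka la ga)) (schur_family n la))"
    using kostka_refl[OF pa]
    by (subst hbasis_eq_sum_schur_family[OF less.prems(1)])
      (simp add: sum.remove[OF finite_partitions_of less.prems(1)])
  from fun_cong[OF this, of be]
  have h: "hbasis ga be = schur_family n ga be +
      (\<Sum>la\<in>partitions_of n - {ga}. of_nat (kostka la ga) * schur_family n la be)"
    by (simp add: sum_fun_apply sscale_def)
  show ?case
  proof (cases "be = ga")
    case False
    hence "(\<Sum>la\<in>partitions_of n - {ga}. of_nat (kostka la ga) * schur_family n la be) \<noteq> 0"
      using h less.prems(2) by (auto simp: hbasis_def)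
    then obtain la where la: "la \<in> partitions_of n - {ga}" "kostka la ga \<noteq> 0" "schur_family n la be \<noteq> 0"
      by (metis (no_types, lifting) sum.neutral mult_eq_0_iff of_nat_0)
    have pl: "is_partition la" using la(1) by (simp add: partitions_of_def)
    have "row_weight la < row_weight ga"
      using kostka_triangular[OF pl pa la(2)] la(1) by blast
    hence "parts la 0 \<le> parts be 0" using less.IH la by blast
    thus ?thesis using kostka_nonzero_first_part[OF pl la(2)] by simp
  qed simp
qed

section \<open>Multiset partitions\<close>

text \<open>Every block contributes at least one element, and a tie forces each block to be a
  singleton. This isolates the leading term of the recursion for \<open>htilde\<close>.\<close>

lemma size_le_size_sum_mset:
  assumes "\<forall>B\<in>#P. B \<noteq> {#}"
  shows "size P \<le> size (\<Sum>\<^sub># P) \<and> (size P = size (\<Sum>\<^sub># P) \<longrightarrow> P = image_mset (\<lambda>x. {#x#}) (\<Sum>\<^sub># P))"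
  using assms
proof (induction P)
  case (add B P)
  have B: "1 \<le> size B" using add.prems by (simp add: Suc_le_eq nonempty_has_size)
  have IH: "size P \<le> size (\<Sum>\<^sub># P)" "size P = size (\<Sum>\<^sub># P) \<Longrightarrow> P = image_mset (\<lambda>x. {#x#}) (\<Sum>\<^sub># P)"
    using add by auto
  show ?case
  proof (intro conjI impI)
    show "size (add_mset B P) \<le> size (\<Sum>\<^sub># (add_mset B P))" using B IH(1) by (simp del: size_mset_sum_mset_conv)
    assume "size (add_mset B P) = size (\<Sum>\<^sub># (add_mset B P))"
    hence e: "Suc (size P) = size B + size (\<Sum>\<^sub># P)" by (simp del: size_mset_sum_mset_conv)
    hence "size B = 1" "size P = size (\<Sum>\<^sub># P)" using B IH(1) by linarith+
    then obtain x where "B = {#x#}" using size_1_singleton_mset by blast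
    thus "add_mset B P = image_mset (\<lambda>x. {#x#}) (\<Sum>\<^sub># (add_mset B P))"
      using IH(2)[OF \<open>size P = size (\<Sum>\<^sub># P)\<close>] by simp
  qed
qed simp

lemma size_mset_partition_le: "P \<in> mset_partitions S \<Longrightarrow> size P \<le> size S"
  using size_le_size_sum_mset[of P] by (auto simp: mset_partitions_def)

lemma mset_partition_singletons:
  "P \<in> mset_partitions S \<Longrightarrow> size P = size S \<Longrightarrow> P = image_mset (\<lambda>x. {#x#}) S"
  using size_le_size_sum_mset[of P] by (auto simp: mset_partitions_def)

lemma finite_mset_partitions: "finite (mset_partitions S)"
proof -
  let ?B = "\<Union>k\<le>size S. multisets_of_size (set_mset S) k"
  have "P \<in> (\<Union>k\<le>size S. multisets_of_size ?B k)" if P: "P \<in> mset_partitions S" for P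
  proof -
    have "B \<in> ?B" if "B \<in># P" for B
    proof -
      have "B \<subseteq># \<Sum>\<^sub># P" using that by (metis multi_member_split mset_subset_eq_add_left sum_mset.add_mset)
      hence "B \<subseteq># S" using P by (simp add: mset_partitions_def)
      thus ?thesis using size_mset_mono[of B S] set_mset_mono[of B S] by (auto simp: multisets_of_size_def)
    qed
    thus ?thesis using size_mset_partition_le[OF P] by (auto simp: multisets_of_size_def)
  qed
  moreover have "finite (\<Union>k\<le>size S. multisets_of_size ?B k)"
    by (intro finite_UN_I finite_multisets_of_size finite_atMost finite_set_mset)
  ultimately show ?thesis by (meson finite_subset subsetI)
qed

lemma mset_mtilde: "mset (mtilde P) = image_mset (count P) (mset_set (set_mset P))"
  by (simp add: mtilde_def)

lemma sum_list_mtilde: "sum_list (mtilde P) = size P"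
proof -
  have "sum_list (mtilde P) = \<Sum>\<^sub># (image_mset (count P) (mset_set (set_mset P)))"
    unfolding mset_mtilde[symmetric] by (rule sum_mset_sum_list[symmetric])
  also have "\<dots> = size P" by (simp add: size_multiset_overloaded_eq sum_unfold_sum_mset)
  finally show ?thesis .
qed

lemma is_partition_mtilde: "is_partition (mtilde P)"
proof -
  have "\<forall>x\<in>set_mset (mset (mtilde P)). 0 < x" unfolding mset_mtilde by auto
  moreover have "sorted_wrt (\<ge>) (mtilde P)"
    unfolding mtilde_def by (simp add: sorted_wrt_rev)
  ultimately show ?thesis by (simp add: is_partition_def)
qed

lemma count_content: "i < length la \<Longrightarrow> count (content la) (Suc i) = la ! i"
  by (simp add: content_def count_sum)

lemma set_mset_content: "set_mset (content la) = {Suc i | i. i < length la \<and> 0 < la ! i}"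
  by (auto simp: content_def set_mset_sum)

lemma size_content: "size (content la) = sum_list la"
proof -
  have "size (\<Sum>i<n. replicate_mset (la ! i) (Suc i)) = (\<Sum>i<n. la ! i)" for n
    by (induction n) auto
  thus ?thesis by (simp add: content_def sum_list_sum_nth atLeast0LessThan)
qed

lemma count_singletons: "count (image_mset (\<lambda>x. {#x#}) M) {#x#} = count M x"
  by (induction M) auto

text \<open>Each part of \<open>la\<close> is the multiplicity of one singleton block; since the
  parts are positive no letter is missing, and decreasing order restores \<open>la\<close>.\<close>

lemma mtilde_singletons:
  assumes "is_partition la"
  shows "mtilde (image_mset (\<lambda>x. {#x#}) (content la)) = la"
proof -
  let ?P = "image_mset (\<lambda>x. {#x#}) (content la)"
  have "set_mset ?P = (\<lambda>i. {#Suc i#}) ` {..<length la}"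
    using assms by (force simp: set_mset_content is_partition_def)
  moreover have "inj_on (\<lambda>i. {#Suc i#}) {..<length la}" by (auto simp: inj_on_def)
  ultimately have "mset (mtilde ?P) = image_mset (\<lambda>i. count ?P {#Suc i#}) (mset_set {..<length la})"
    by (simp add: mset_mtilde image_mset_mset_set[symmetric] multiset.map_comp comp_def)
  also have "\<dots> = image_mset (nth la) (mset_set {..<length la})"
  proof (intro image_mset_cong)
    fix i assume "i \<in># mset_set {..<length la}"
    hence i: "i < length la" by simp
    have "count ?P {#Suc i#} = count (content la) (Suc i)"
      by (rule count_singletons)
    thus "count ?P {#Suc i#} = la ! i" using count_content[OF i] by simp
  qed
  also have "\<dots> = mset la"
    by (metis atLeast0LessThan map_nth mset_map mset_upt)
  finally have "mset (mtilde ?P) = mset la" .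
  hence "image_mset (count ?P) (mset_set (set_mset ?P)) = mset la" by (simp only: mset_mtilde)
  hence "mtilde ?P = rev (sort la)" unfolding mtilde_def by simp
  also have "sort la = rev la"
    using assms by (intro properties_for_sort) (auto simp: is_partition_def sorted_wrt_rev)
  finally show ?thesis by simp
qed

text \<open>The partition into singletons contributes \<open>H la\<close> itself, and every other
  multiset partition has fewer blocks, so the system is triangular with respect to
  \<open>sum_list\<close>.\<close>

lemma htilde_family_exists_unique:
  "\<exists>!H. (\<forall>la. is_partition la \<longrightarrow>
         hbasis la = (\<Sum>P\<in>mset_partitions (content la). H (mtilde P)))
    \<and> (\<forall>la. \<not> is_partition la \<longrightarrow> H la = 0)"
proof -
  let ?P0 = "\<lambda>la. image_mset (\<lambda>x. {#x#}) (content la)"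
  let ?F = "\<lambda>H la. hbasis la - (\<Sum>P\<in>mset_partitions (content la) - {?P0 la}. H (mtilde P))"
  have ex1: "\<exists>!H. (\<forall>la\<in>{la. is_partition la}. H la = ?F H la) \<and> (\<forall>la. la \<notin> {la. is_partition la} \<longrightarrow> H la = 0)"
  proof (rule ex1_measure_recursion[where r = sum_list])
    fix H H' :: "nat list \<Rightarrow> sym" and la
    assume eq: "\<And>nu. sum_list nu < sum_list la \<Longrightarrow> H nu = H' nu"
    have "H (mtilde P) = H' (mtilde P)" if "P \<in> mset_partitions (content la) - {?P0 la}" for P
      using that size_mset_partition_le[of P "content la"] mset_partition_singletons[of P "content la"]
      by (intro eq) (auto simp: sum_list_mtilde size_content order_less_le)
    thus "?F H la = ?F H' la" by simp
  qed
  have eq: "hbasis la = (\<Sum>P\<in>mset_partitions (content la). H (mtilde P)) \<longleftrightarrow> H la = ?F H la"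
    if la: "is_partition la" for H la
  proof -
    have "?P0 la \<in> mset_partitions (content la)" by (auto simp: mset_partitions_def)
    hence "(\<Sum>P\<in>mset_partitions (content la). H (mtilde P)) =
        H la + (\<Sum>P\<in>mset_partitions (content la) - {?P0 la}. H (mtilde P))"
      by (simp add: sum.remove[OF finite_mset_partitions] mtilde_singletons[OF la])
    thus ?thesis by (simp only: eq_diff_eq) (rule eq_commute)
  qed
  hence eq: "(\<forall>la. is_partition la \<longrightarrow> hbasis la = (\<Sum>P\<in>mset_partitions (content la). H (mtilde P))) \<longleftrightarrow>
      (\<forall>la\<in>{la. is_partition la}. H la = ?F H la)" for H
    unfolding Ball_def mem_Collect_eq by (intro all_cong1 imp_cong refl)
  show ?thesis unfolding eq using ex1 unfolding mem_Collect_eq .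
qed

lemma hbasis_eq_sum_htilde:
  assumes "is_partition la"
  shows "hbasis la = (\<Sum>P\<in>mset_partitions (content la). htilde (mtilde P))"
  using theI'[OF htilde_family_exists_unique] assms unfolding htilde_def htilde_family_def by blast

section \<open>Stable Kostka numbers\<close>

text \<open>The Kostka number of \<open>(n - |\<lambda>|, \<lambda>)\<close> and \<open>(n - |\<nu>|, \<nu>)\<close> for large \<open>n\<close>.  The entries
  \<open>1\<close> fill an initial segment of the bottom row; once it is at least as long as the second
  row its length no longer matters, so it may be taken equal to the second row.\<close>

definition stable_kostka :: "nat list \<Rightarrow> nat list \<Rightarrow> nat" where
  "stable_kostka la nu = strip_chains (Suc (length la)) (row (parts la 0))
     (parts ((parts la 0 + (sum_list nu - sum_list la)) # la)) (rev nu)"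

lemma prepend_partition:
  assumes "is_partition la" "parts la 0 \<le> k"
  shows "is_partition (prepend k la)"
  using assms by (cases la) (auto simp: prepend_def is_partition_def dest: order_trans)

text \<open>\<open>prepend 0\<close> adds no row, so \<open>tl\<close> would not undo it in general;
  this confines the degenerate case to the empty partition.\<close>

lemma prepend_diff_zeroD:
  assumes "2 * sum_list la \<le> n" "is_partition la" "n - sum_list la = 0"
  shows "n = 0" "la = []"
proof -
  have "sum_list la = 0" "n = 0" using assms by linarith+
  thus "n = 0" "la = []" using assms(2) by (cases la; auto simp: is_partition_def)+
qed

lemma prepend_in_partitions_of:
  assumes "is_partition la" "2 * sum_list la \<le> n"
  shows "prepend (n - sum_list la) la \<in> partitions_of n"
proof -
  have "parts la 0 \<le> n - sum_list la" using parts_0_le_sum_list[of la] assms(2) by linarith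
  hence "is_partition (prepend (n - sum_list la) la)" by (rule prepend_partition[OF assms(1)])
  moreover have "sum_list (prepend (n - sum_list la) la) = n" using assms(2) by (simp add: prepend_def)
  ultimately show ?thesis by (simp add: partitions_of_def)
qed

lemma tl_prepend:
  assumes "is_partition la" "2 * sum_list la \<le> n"
  shows "tl (prepend (n - sum_list la) la) = la"
  using prepend_diff_zeroD[OF assms(2,1)] by (auto simp: prepend_def)

lemma parts_prepend_0:
  assumes "is_partition la" "2 * sum_list la \<le> n"
  shows "parts (prepend (n - sum_list la) la) 0 = n - sum_list la"
  using prepend_diff_zeroD[OF assms(2,1)] by (auto simp: prepend_def)

lemma is_partition_tl: "is_partition la \<Longrightarrow> is_partition (tl la)"
  by (cases la) (auto simp: is_partition_def)

lemma sum_list_tl: "sum_list (tl la) = sum_list la - parts la 0"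
  by (cases la) auto

lemma prepend_tl:
  assumes "ga \<in> partitions_of n"
  shows "prepend (n - sum_list (tl ga)) (tl ga) = ga"
  using assms by (cases ga) (auto simp: partitions_of_def prepend_def is_partition_def)

text \<open>For \<open>2 * r \<le> n\<close> the missing first part is at least as large as every
  part of \<open>la\<close>, so restoring it is inverse to \<open>tl\<close>.\<close>

lemma sum_stable_partitions:
  fixes f :: "nat list \<Rightarrow> 'b::comm_monoid_add"
  assumes "2 * r \<le> n"
  shows "(\<Sum>la\<in>{la. is_partition la \<and> sum_list la \<le> r}. f (prepend (n - sum_list la) la)) =
    (\<Sum>ga\<in>{ga \<in> partitions_of n. sum_list (tl ga) \<le> r}. f ga)"
proof (rule sum.reindex_bij_witness[where i = tl and j = "\<lambda>la. prepend (n - sum_list la) la"])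
  fix la assume la: "la \<in> {la. is_partition la \<and> sum_list la \<le> r}"
  hence "2 * sum_list la \<le> n" using assms by simp
  with la show "tl (prepend (n - sum_list la) la) = la"
    "prepend (n - sum_list la) la \<in> {ga \<in> partitions_of n. sum_list (tl ga) \<le> r}"
    using tl_prepend[of la n] prepend_in_partitions_of[of la n] by auto
qed (auto simp: prepend_tl intro: is_partition_tl simp: partitions_of_def[of n])

text \<open>The entries 1 are the innermost strip, a segment of the bottom row; stripping them off
  and shortening the bottom row eliminates \<open>n\<close>.\<close>

lemma kostka_prepend:
  assumes la: "is_partition la" and nu: "is_partition nu"
    and le: "sum_list la \<le> sum_list nu" "2 * sum_list nu \<le> n"
  shows "kostka (prepend (n - sum_list la) la) (prepend (n - sum_list nu) nu) = stable_kostka la nu"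
proof (cases "n = 0")
  \<comment> \<open>Nothing is prepended here, and both sides count the empty tableau.\<close>
  case True
  hence "2 * sum_list la \<le> 0" "2 * sum_list nu \<le> 0" using le by linarith+
  hence "la = []" "nu = []" using prepend_diff_zeroD(2)[of _ 0] la nu by simp_all
  moreover have "row 0 = parts [0]" by (auto simp: row_def parts_def)
  ultimately show ?thesis using True kostka_refl[of "[]"]
    by (simp add: stable_kostka_def prepend_def is_partition_def)
next
  case False
  let ?L = "Suc (length la)"
  define c where "c = n - sum_list nu"
  \<comment> \<open>The excess of the number of entries 1 over the second row of the shape.\<close>
  define d where "d = c - parts la 0"
  have c0: "parts la 0 \<le> c" using parts_0_le_sum_list[of la] le by (simp add: c_def)
  have pre: "prepend (n - sum_list la) la = (n - sum_list la) # la" "prepend c nu = c # nu"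
    using False le by (auto simp: prepend_def c_def)
  have part: "is_partition ((n - sum_list la) # la)"
    using prepend_in_partitions_of[OF la, of n] le unfolding pre by (simp add: partitions_of_def)
  let ?ga = "parts ((n - sum_list la) # la)"
  let ?s = "parts ((parts la 0 + (sum_list nu - sum_list la)) # la)"
  have van: "\<forall>i\<ge>?L. parts (a # la) i = 0" for a by (rule parts_vanish) simp
  have shift: "?ga = ?s(0 := ?s 0 + d)"
  proof
    fix i show "?ga i = (?s(0 := ?s 0 + d)) i"
      using c0 le by (cases i) (auto simp: d_def c_def)
  qed
  have "kostka ((n - sum_list la) # la) (c # nu) = strip_chains ?L 0 ?ga (rev nu @ [c])"
    using kostka_eq_strip_chains[OF part, of ?L] by simp
  also have "\<dots> = strip_chains ?L (row c) ?ga (rev nu)"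
    using van sum_parts[of "(n - sum_list la) # la" ?L] le by (intro strip_chains_snoc) (auto simp: c_def)
  also have "row c = row (parts la 0 + d)" using c0 by (simp add: d_def)
  also have "strip_chains ?L (row (parts la 0 + d)) ?ga (rev nu) = stable_kostka la nu"
    unfolding shift stable_kostka_def
    by (rule strip_chains_shift_row[symmetric, OF van]) simp_all
  finally show ?thesis unfolding pre(1) pre(2)[unfolded c_def] c_def .
qed

text \<open>The image of \<open>s\<^bsub>(n - |\<lambda>|, \<lambda>)\<^esub>\<close> under the linear map sending \<open>h\<^sub>\<beta>\<close>, for a partition \<open>\<beta>\<close> of \<open>n\<close>,
  to the \<open>htilde\<close> indexed by \<open>\<beta>\<close> without its first part.\<close>

definition stilde_at :: "nat \<Rightarrow> nat list \<Rightarrow> sym" where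
  "stilde_at n la = (\<Sum>be\<in>partitions_of n. sscale (schur_family n (prepend (n - sum_list la) la) be) (htilde (tl be)))"

text \<open>Cutting the defining sum at \<open>sum_list mu \<le> sum_list la\<close> loses nothing:
  a \<open>be\<close> with a larger tail has a first part smaller than that of the shape, and
  \<open>schur_family_support\<close> makes its coefficient 0.\<close>

lemma stilde_eq_stilde_at:
  assumes la: "is_partition la"
  shows "stilde la = stilde_at (2 * sum_list la) la"
proof -
  define n where "n = 2 * sum_list la"
  define ga where "ga = prepend (n - sum_list la) la"
  have ga: "ga \<in> partitions_of n" unfolding ga_def by (rule prepend_in_partitions_of[OF la]) (simp add: n_def)
  hence schur: "Kinv ga = schur_family n ga" by (simp add: fun_eq_iff Kinv_def schur_def partitions_of_def)
  let ?f = "\<lambda>be. sscale (schur_family n ga be) (htilde (tl be))"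
  have "stilde la = (\<Sum>mu\<in>{mu. is_partition mu \<and> sum_list mu \<le> sum_list la}.
        sscale (schur_family n ga (prepend (n - sum_list mu) mu)) (htilde mu))"
    unfolding schur[symmetric] unfolding stilde_def Let_def n_def[symmetric] ga_def[symmetric] ..
  also have "\<dots> = (\<Sum>mu\<in>{mu. is_partition mu \<and> sum_list mu \<le> sum_list la}. ?f (prepend (n - sum_list mu) mu))"
    by (intro sum.cong refl) (auto simp: tl_prepend n_def)
  also have "\<dots> = (\<Sum>be\<in>{be \<in> partitions_of n. sum_list (tl be) \<le> sum_list la}. ?f be)"
    by (rule sum_stable_partitions) (simp add: n_def)
  also have "\<dots> = (\<Sum>be\<in>partitions_of n. ?f be)"
  proof (rule sum.mono_neutral_left[OF finite_partitions_of])
    show "\<forall>be\<in>partitions_of n - {be \<in> partitions_of n. sum_list (tl be) \<le> sum_list la}. ?f be = 0"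
    proof
      fix be assume be: "be \<in> partitions_of n - {be \<in> partitions_of n. sum_list (tl be) \<le> sum_list la}"
      have "parts ga 0 = n - sum_list la"
        unfolding ga_def by (rule parts_prepend_0[OF la]) (simp add: n_def)
      hence "\<not> parts ga 0 \<le> parts be 0"
        using be sum_list_tl[of be] by (auto simp: partitions_of_def n_def)
      hence "schur_family n ga be = 0" using schur_family_support[OF ga] by blast
      thus "?f be = 0" by simp
    qed
  qed auto
  finally show ?thesis by (simp add: stilde_at_def ga_def n_def)
qed

text \<open>The expansion of \<open>h\<close> for \<open>(n - |\<nu>|, \<nu>)\<close> in Schur
  functions is sent through the linear map behind \<open>stilde_at\<close>. Shapes with a first part
  below \<open>n - |\<nu>|\<close> have Kostka number 0, and the others have stable ones.\<close>

lemma htilde_eq_sum_stilde_at: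
  assumes nu: "is_partition nu" "2 * sum_list nu \<le> n"
  shows "htilde nu = (\<Sum>la\<in>{la. is_partition la \<and> sum_list la \<le> sum_list nu}.
      sscale (of_nat (stable_kostka la nu)) (stilde_at n la))"
proof
  fix x
  define be0 where "be0 = prepend (n - sum_list nu) nu"
  have be0: "be0 \<in> partitions_of n" unfolding be0_def by (rule prepend_in_partitions_of[OF nu])
  let ?A = "{la. is_partition la \<and> sum_list la \<le> sum_list nu}"
  let ?g = "\<lambda>be ga. of_nat (kostka ga be0) * schur_family n ga be"
  have coeff: "(\<Sum>la\<in>?A. of_nat (stable_kostka la nu) * schur_family n (prepend (n - sum_list la) la) be) = hbasis be0 be" for be
  proof -
    have "(\<Sum>la\<in>?A. of_nat (stable_kostka la nu) * schur_family n (prepend (n - sum_list la) la) be) =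
        (\<Sum>la\<in>?A. ?g be (prepend (n - sum_list la) la))"
      by (intro sum.cong refl) (auto simp: be0_def kostka_prepend[OF _ nu(1) _ nu(2)])
    also have "\<dots> = (\<Sum>ga\<in>{ga \<in> partitions_of n. sum_list (tl ga) \<le> sum_list nu}. ?g be ga)"
      by (rule sum_stable_partitions[OF nu(2)])
    also have "\<dots> = (\<Sum>ga\<in>partitions_of n. ?g be ga)"
    proof (rule sum.mono_neutral_left[OF finite_partitions_of])
      show "\<forall>ga\<in>partitions_of n - {ga \<in> partitions_of n. sum_list (tl ga) \<le> sum_list nu}. ?g be ga = 0"
      proof
        fix ga assume ga: "ga \<in> partitions_of n - {ga \<in> partitions_of n. sum_list (tl ga) \<le> sum_list nu}"
        have "parts be0 0 = n - sum_list nu" unfolding be0_def by (rule parts_prepend_0[OF nu])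
        hence "\<not> parts be0 0 \<le> parts ga 0"
          using ga sum_list_tl[of ga] nu(2) by (auto simp: partitions_of_def)
        moreover have "is_partition ga" using ga by (simp add: partitions_of_def)
        ultimately have "kostka ga be0 = 0" using kostka_nonzero_first_part by blast
        thus "?g be ga = 0" by simp
      qed
    qed auto
    also have "\<dots> = hbasis be0 be"
      by (subst hbasis_eq_sum_schur_family[OF be0]) (simp add: sum_fun_apply sscale_def)
    finally show ?thesis .
  qed
  have "(\<Sum>la\<in>?A. sscale (of_nat (stable_kostka la nu)) (stilde_at n la)) x =
      (\<Sum>la\<in>?A. \<Sum>be\<in>partitions_of n.
         of_nat (stable_kostka la nu) * schur_family n (prepend (n - sum_list la) la) be * htilde (tl be) x)"
    by (simp add: sum_fun_apply sscale_def stilde_at_def sum_distrib_left mult.assoc)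
  also have "\<dots> = (\<Sum>be\<in>partitions_of n. (\<Sum>la\<in>?A.
         of_nat (stable_kostka la nu) * schur_family n (prepend (n - sum_list la) la) be) * htilde (tl be) x)"
    by (subst sum.swap) (simp only: sum_distrib_right)
  also have "\<dots> = (\<Sum>be\<in>partitions_of n. if be = be0 then htilde (tl be) x else 0)"
    unfolding coeff by (intro sum.cong refl) (simp add: hbasis_def)
  also have "\<dots> = htilde (tl be0) x" using be0 by (simp add: finite_partitions_of)
  also have "tl be0 = nu" unfolding be0_def by (rule tl_prepend[OF nu])
  finally show "htilde nu x = (\<Sum>la\<in>?A. sscale (of_nat (stable_kostka la nu)) (stilde_at n la)) x" by simp
qed

text \<open>The coefficients in \<open>htilde_eq_sum_stilde_at\<close> are free of \<open>n\<close>
  and unitriangular, so solving for the diagonal term by induction gives the same result for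
  \<open>n\<close> and \<open>m\<close>.\<close>

lemma stilde_at_independent:
  assumes "is_partition la" "2 * sum_list la \<le> n" "2 * sum_list la \<le> m"
  shows "stilde_at n la = stilde_at m la"
  using assms
proof (induction la rule: measure_induct_rule[of "\<lambda>la. row_weight (prepend (n - sum_list la) la)"])
  case (less la)
  let ?A = "{mu. is_partition mu \<and> sum_list mu \<le> sum_list la}"
  have la: "la \<in> ?A" using less.prems by simp
  have fin: "finite ?A" by (rule finite_partitions_le)
  have sk: "stable_kostka mu la = kostka (prepend (n - sum_list mu) mu) (prepend (n - sum_list la) la)"
    if "mu \<in> ?A" for mu
    using kostka_prepend[of mu la n] that less.prems by simp
  have part: "is_partition (prepend (n - sum_list mu) mu)" if "mu \<in> ?A" for mu
    using prepend_in_partitions_of[of mu n] that less.prems by (auto simp: partitions_of_def)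
  have diag: "stable_kostka la la = 1"
    unfolding sk[OF la] by (rule kostka_refl[OF part[OF la]])
  have split: "htilde la = stilde_at k la + (\<Sum>mu\<in>?A - {la}. sscale (of_nat (stable_kostka mu la)) (stilde_at k mu))"
    if "2 * sum_list la \<le> k" for k
    unfolding htilde_eq_sum_stilde_at[OF less.prems(1) that] sum.remove[OF fin la] diag by simp
  have rest: "sscale (of_nat (stable_kostka mu la)) (stilde_at n mu) = sscale (of_nat (stable_kostka mu la)) (stilde_at m mu)"
    if mu: "mu \<in> ?A - {la}" for mu
  proof (cases "stable_kostka mu la = 0")
    case False
    have ne: "prepend (n - sum_list mu) mu \<noteq> prepend (n - sum_list la) la"
    proof
      assume "prepend (n - sum_list mu) mu = prepend (n - sum_list la) la"
      hence "tl (prepend (n - sum_list mu) mu) = tl (prepend (n - sum_list la) la)" by simp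
      thus False using mu less.prems by (auto simp: tl_prepend)
    qed
    have "row_weight (prepend (n - sum_list mu) mu) < row_weight (prepend (n - sum_list la) la)"
      using mu la False sk ne by (intro kostka_triangular part) auto
    hence "stilde_at n mu = stilde_at m mu" using mu less.prems by (intro less.IH) auto
    thus ?thesis by simp
  qed simp
  have sums: "(\<Sum>mu\<in>?A - {la}. sscale (of_nat (stable_kostka mu la)) (stilde_at n mu)) =
      (\<Sum>mu\<in>?A - {la}. sscale (of_nat (stable_kostka mu la)) (stilde_at m mu))"
    by (intro sum.cong refl rest)
  have "stilde_at n la + (\<Sum>mu\<in>?A - {la}. sscale (of_nat (stable_kostka mu la)) (stilde_at m mu)) =
      stilde_at m la + (\<Sum>mu\<in>?A - {la}. sscale (of_nat (stable_kostka mu la)) (stilde_at m mu))"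
    using split[OF less.prems(2), unfolded sums] split[OF less.prems(3)] by (rule trans[OF sym])
  thus ?case by simp
qed

text \<open>The common value \<open>n = 2 * sum_list nu\<close> is large enough for all
  \<open>la\<close> in the sum; independence then replaces it by the value
  \<open>2 * sum_list la\<close> used in \<open>stilde\<close>.\<close>

lemma htilde_eq_sum_stilde:
  assumes nu: "is_partition nu"
  shows "htilde nu = (\<Sum>la\<in>{la. is_partition la \<and> sum_list la \<le> sum_list nu}.
      sscale (of_nat (stable_kostka la nu)) (stilde la))"
proof -
  have "stilde_at (2 * sum_list nu) la = stilde la" if "is_partition la" "sum_list la \<le> sum_list nu" for la
    using that stilde_at_independent[of la "2 * sum_list nu" "2 * sum_list la"]
    by (simp add: stilde_eq_stilde_at)
  thus ?thesis
    unfolding htilde_eq_sum_stilde_at[OF nu order_refl] by (intro sum.cong refl) auto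
qed

section \<open>Tableaux of multisets\<close>

text \<open>The order on multisets is the linear order on words pulled back along the injective
  sorted listing, which makes facts on linear orders available.\<close>

lemma mset_less_iff: "mset_less A B \<longleftrightarrow> sorted_list_of_multiset A < sorted_list_of_multiset B"
  by (simp add: mset_less_def list_less_def)

lemma mset_le_iff: "mset_le A B \<longleftrightarrow> sorted_list_of_multiset A \<le> sorted_list_of_multiset B"
proof -
  have "A = B \<longleftrightarrow> sorted_list_of_multiset A = sorted_list_of_multiset B"
    by (metis mset_sorted_list_of_multiset)
  thus ?thesis unfolding mset_le_def mset_less_iff by auto
qed

lemma sorted_blocks_exist:
  assumes "finite A"
  obtains xs where "set xs = A" "distinct xs" "sorted_wrt mset_less xs"
proof
  let ?ys = "sorted_list_of_set (sorted_list_of_multiset ` A)"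
  have fin: "finite (sorted_list_of_multiset ` A)" using assms by simp
  have inv: "sorted_list_of_multiset (mset y) = y" if "y \<in> set ?ys" for y
    using that fin by auto
  show "set (map mset ?ys) = A" using fin by (auto simp: image_image)
  have "sorted_wrt (<) ?ys" by simp
  hence "sorted_wrt (\<lambda>x y. mset_less (mset x) (mset y)) ?ys"
    by (rule sorted_wrt_mono_rel[rotated]) (simp add: mset_less_iff inv del: sorted_list_of_multiset_mset)
  thus "sorted_wrt mset_less (map mset ?ys)" by (simp add: sorted_wrt_map)
  show "distinct (map mset ?ys)"
    unfolding distinct_map using fin by (auto intro!: inj_onI)
qed

definition block_tableaux :: "nat list \<Rightarrow> nat multiset multiset \<Rightarrow> (nat \<times> nat \<Rightarrow> nat multiset) set" where
  "block_tableaux la P = {T. (\<forall>c. c \<notin> filled la \<longrightarrow> T c = {#})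
      \<and> image_mset T (mset_set (filled la)) = P
      \<and> (\<forall>i j. (i, j) \<in> filled la \<and> (i, Suc j) \<in> filled la \<longrightarrow> mset_le (T (i, j)) (T (i, Suc j)))
      \<and> (\<forall>i j. (i, j) \<in> filled la \<and> (Suc i, j) \<in> filled la \<longrightarrow> mset_less (T (i, j)) (T (Suc i, j)))}"

lemma second_part_eq: "second_part la = parts (tl la) 0"
  by (cases la; cases "tl la") (auto simp: second_part_def)

lemma filled_eq_skew: "filled la = skew (row (parts (tl la) 0)) (parts la)"
  unfolding filled_def second_part_eq cells_eq_skew by (auto simp: skew_def row_def)

lemma row_le_parts: "is_partition la \<Longrightarrow> row (parts (tl la) 0) \<le> parts la"
  using parts_antimono[of la 0] by (cases la) (auto simp: row_def le_fun_def)

lemma finite_filled: "finite (filled la)"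
  unfolding filled_def using finite_cells by simp

lemma card_filled:
  assumes "is_partition la"
  shows "card (filled la) + parts (tl la) 0 = sum_list la"
proof -
  let ?L = "Suc (length la)"
  have "sum (row k) {..<?L} = k" for k
    by (subst sum.lessThan_Suc_shift) (simp add: row_def)
  thus ?thesis
    using card_skew[OF parts_vanish row_le_parts[OF assms], of ?L] sum_parts[of la ?L]
    by (simp add: filled_eq_skew)
qed

lemma count_image_mset_set:
  "finite S \<Longrightarrow> count (image_mset f (mset_set S)) y = card {c \<in> S. f c = y}"
  by (simp add: count_image_mset' eq_commute[of y])

text \<open>Replacing each block by its rank among the distinct blocks gives integer tableaux whose
  content lists the multiplicities in block order.\<close>

lemma block_tableaux_count:
  assumes la: "is_partition la" "length la \<le> L" and P: "{#} \<notin># P"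
  shows "finite (block_tableaux la P) \<and>
    card (block_tableaux la P) = strip_chains L (row (parts (tl la) 0)) (parts la) (rev (mtilde P))"
proof -
  obtain xs where xs: "set xs = set_mset P" "distinct xs" "sorted_wrt mset_less xs"
    by (rule sorted_blocks_exist[OF finite_set_mset])
  define m where "m = length xs"
  \<comment> \<open>Rank 0 stands for the empty multiset, so the default values outside the shape
    correspond; ranks of blocks start at 1. As \<open>P\<close> has no empty block,
    \<open>lab\<close> is injective.\<close>
  define lab where "lab k = ({#} # xs) ! k" for k
  define al where "al = map (count P) xs"
  define rho where "rho = row (parts (tl la) 0)"
  let ?S = "filled la"
  have S: "?S = skew rho (parts la)" by (simp add: filled_eq_skew rho_def)
  have lab_0: "lab 0 = {#}" and lab_Suc: "lab (Suc k) = xs ! k" for k by (simp_all add: lab_def)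
  have less: "mset_less (xs ! k) (xs ! l)" if "k < l" "l < m" for k l
    using sorted_wrt_nth_less[OF xs(3)] that by (simp add: m_def)
  have less_iff: "mset_less (lab k) (lab l) \<longleftrightarrow> k < l"
    and le_iff: "mset_le (lab k) (lab l) \<longleftrightarrow> k \<le> l" if kl: "1 \<le> k" "k \<le> m" "1 \<le> l" "l \<le> m" for k l
  proof -
    obtain k' where k: "k = Suc k'" "k' < m" using kl(1,2) by (cases k) auto
    obtain l' where l: "l = Suc l'" "l' < m" using kl(3,4) by (cases l) auto
    have mono: "strict_mono_on {..<m} (\<lambda>j. sorted_list_of_multiset (xs ! j))"
      using less by (intro strict_mono_onI) (simp add: mset_less_iff)
    show "mset_less (lab k) (lab l) \<longleftrightarrow> k < l"
      unfolding k(1) l(1) lab_Suc mset_less_iff using strict_mono_on_less[OF mono, of k' l'] k(2) l(2) by simp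
    show "mset_le (lab k) (lab l) \<longleftrightarrow> k \<le> l"
      unfolding k(1) l(1) lab_Suc mset_le_iff using strict_mono_on_less_eq[OF mono, of k' l'] k(2) l(2) by simp
  qed
  have lab_in: "lab k \<in># P" if k: "1 \<le> k" "k \<le> m" for k
  proof -
    obtain k' where k': "k = Suc k'" "k' < length xs" using k by (cases k) (auto simp: m_def)
    show ?thesis unfolding k'(1) lab_Suc xs(1)[symmetric] by (rule nth_mem[OF k'(2)])
  qed
  have lab_inj: "inj_on lab {..m}"
  proof -
    have "distinct ({#} # xs)" using xs(1,2) P by simp
    thus ?thesis unfolding lab_def m_def by (intro inj_on_nth) auto
  qed
  have len: "length al = m" by (simp add: al_def m_def)
  have bound: "T c \<le> m" if "T \<in> skew_ssyt rho (parts la) al" for T c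
    using that by (cases "c \<in> ?S") (simp_all add: S skew_ssyt_outside, simp add: skew_ssyt_def len)
  have bij: "bij_betw (\<lambda>T. lab \<circ> T) (skew_ssyt rho (parts la) al) (block_tableaux la P)"
    unfolding bij_betw_def
  proof (intro conjI equalityI subsetI)
    show "inj_on (\<lambda>T. lab \<circ> T) (skew_ssyt rho (parts la) al)"
    proof (rule inj_onI, rule ext)
      fix T T' c assume T: "T \<in> skew_ssyt rho (parts la) al" "T' \<in> skew_ssyt rho (parts la) al" "lab \<circ> T = lab \<circ> T'"
      show "T c = T' c"
        using inj_onD[OF lab_inj, of "T c" "T' c"] fun_cong[OF T(3), of c] bound[OF T(1)] bound[OF T(2)] by simp
    qed
  next
    fix U assume "U \<in> (\<lambda>T. lab \<circ> T) ` skew_ssyt rho (parts la) al"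
    then obtain T where T: "T \<in> skew_ssyt rho (parts la) al" and U: "U = lab \<circ> T" by blast
    have T0: "T c = 0" if "c \<notin> ?S" for c using skew_ssyt_outside[OF T] that S by simp
    have T1: "1 \<le> T c" "T c \<le> m" if "c \<in> ?S" for c using T that by (auto simp: skew_ssyt_def S len)
    have "count (image_mset U (mset_set ?S)) B = count P B" for B
    proof (cases "B \<in> set xs")
      case True
      then obtain k where k: "k < m" "B = xs ! k" by (auto simp: in_set_conv_nth m_def)
      have "{c \<in> ?S. U c = B} = {c \<in> ?S. T c = Suc k}"
      proof -
        have "lab (T c) = lab (Suc k) \<longleftrightarrow> T c = Suc k" if "c \<in> ?S" for c
          using inj_on_eq_iff[OF lab_inj, of "T c" "Suc k"] T1[OF that] k(1) by simp
        thus ?thesis by (auto simp: U k(2) lab_Suc)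
      qed
      moreover have "card {c \<in> ?S. T c = Suc k} = count P B"
        using T k len by (simp add: skew_ssyt_def S al_def m_def)
      ultimately show ?thesis by (simp add: count_image_mset_set[OF finite_filled])
    next
      case False
      have "U c \<noteq> B" if "c \<in> ?S" for c using lab_in[OF T1[OF that]] False xs(1) by (auto simp: U)
      hence "{c \<in> ?S. U c = B} = {}" by blast
      moreover have "count P B = 0" using False xs(1) by (simp add: not_in_iff)
      ultimately show ?thesis by (simp only: count_image_mset_set[OF finite_filled] card.empty)
    qed
    hence "image_mset U (mset_set ?S) = P" by (rule multiset_eqI)
    moreover have "\<forall>c. c \<notin> ?S \<longrightarrow> U c = {#}" using T0 lab_0 by (simp add: U)
    moreover have "mset_le (U (i, j)) (U (i, Suc j))" if "(i, j) \<in> ?S" "(i, Suc j) \<in> ?S" for i j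
    proof -
      have "T (i, j) \<le> T (i, Suc j)" using T that by (simp add: skew_ssyt_def S)
      thus ?thesis unfolding U comp_def le_iff[OF T1[OF that(1)] T1[OF that(2)]] .
    qed
    moreover have "mset_less (U (i, j)) (U (Suc i, j))" if "(i, j) \<in> ?S" "(Suc i, j) \<in> ?S" for i j
    proof -
      have "T (i, j) < T (Suc i, j)" using T that by (simp add: skew_ssyt_def S)
      thus ?thesis unfolding U comp_def less_iff[OF T1[OF that(1)] T1[OF that(2)]] .
    qed
    ultimately show "U \<in> block_tableaux la P" unfolding block_tableaux_def by blast
  next
    fix U assume U: "U \<in> block_tableaux la P"
    have U0: "U c = {#}" if "c \<notin> ?S" for c
      using U that by (cases c) (simp add: block_tableaux_def)
    have UP: "image_mset U (mset_set ?S) = P" using U by (simp add: block_tableaux_def)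
    have "\<forall>c\<in>?S. \<exists>k. k \<in> {1..m} \<and> lab k = U c"
    proof
      fix c assume "c \<in> ?S"
      hence "U c \<in># P" unfolding UP[symmetric] using finite_filled by simp
      hence "U c \<in> set xs" using xs(1) by simp
      then obtain k where "k < m" "xs ! k = U c" unfolding in_set_conv_nth m_def by blast
      thus "\<exists>k. k \<in> {1..m} \<and> lab k = U c" by (intro exI[of _ "Suc k"]) (simp add: lab_Suc)
    qed
    from bchoice[OF this] obtain idx
      where idx: "\<And>c. c \<in> ?S \<Longrightarrow> idx c \<in> {1..m} \<and> lab (idx c) = U c" by blast
    define T where "T c = (if c \<in> ?S then idx c else 0)" for c
    have UT: "U = lab \<circ> T"
    proof
      fix c show "U c = (lab \<circ> T) c" using idx[of c] U0[of c] lab_0 by (simp add: T_def)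
    qed
    have T1: "1 \<le> T c" "T c \<le> m" if "c \<in> ?S" for c using idx[OF that] that by (auto simp: T_def)
    have "rho \<le> parts la" unfolding rho_def by (rule row_le_parts[OF la(1)])
    moreover have "\<forall>c. c \<notin> ?S \<longrightarrow> T c = 0" by (simp add: T_def)
    moreover have "\<forall>c\<in>?S. 1 \<le> T c \<and> T c \<le> length al" using T1 len by simp
    moreover have "T (i, j) \<le> T (i, Suc j)" if "(i, j) \<in> ?S" "(i, Suc j) \<in> ?S" for i j
    proof -
      have "mset_le (U (i, j)) (U (i, Suc j))" using U that by (simp add: block_tableaux_def)
      thus ?thesis unfolding UT comp_def le_iff[OF T1[OF that(1)] T1[OF that(2)]] .
    qed
    moreover have "T (i, j) < T (Suc i, j)" if "(i, j) \<in> ?S" "(Suc i, j) \<in> ?S" for i j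
    proof -
      have "mset_less (U (i, j)) (U (Suc i, j))" using U that by (simp add: block_tableaux_def)
      thus ?thesis unfolding UT comp_def less_iff[OF T1[OF that(1)] T1[OF that(2)]] .
    qed
    moreover have "card {c \<in> ?S. T c = Suc k} = al ! k" if k: "k < length al" for k
    proof -
      have "lab (T c) = lab (Suc k) \<longleftrightarrow> T c = Suc k" if "c \<in> ?S" for c
        using inj_on_eq_iff[OF lab_inj, of "T c" "Suc k"] T1[OF that] k len by simp
      hence "{c \<in> ?S. T c = Suc k} = {c \<in> ?S. U c = xs ! k}" by (auto simp: UT lab_Suc)
      hence "card {c \<in> ?S. T c = Suc k} = count P (xs ! k)"
        unfolding UP[symmetric] count_image_mset_set[OF finite_filled] by simp
      thus ?thesis using k by (simp add: al_def)
    qed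
    ultimately have "T \<in> skew_ssyt rho (parts la) al" unfolding skew_ssyt_def S by blast
    thus "U \<in> (\<lambda>T. lab \<circ> T) ` skew_ssyt rho (parts la) al" using UT by blast
  qed
  have count: "finite (skew_ssyt rho (parts la) al) \<and>
      card (skew_ssyt rho (parts la) al) = strip_chains L rho (parts la) (rev al)"
    by (rule skew_ssyt_count[OF parts_vanish[OF la(2)]])
      (simp_all add: parts_antimono[OF la(1)] rho_def row_def)
  \<comment> \<open>\<open>al\<close> has the multiplicities in block order and
    \<open>mtilde P\<close> in decreasing order; the symmetry of chain counts bridges the
    two.\<close>
  have perm: "strip_chains L rho (parts la) (rev al) = strip_chains L rho (parts la) (rev (mtilde P))"
  proof (rule strip_chains_permute[OF parts_vanish[OF la(2)]])
    have "mset xs = mset_set (set_mset P)" using mset_set_set[OF xs(2)] xs(1) by simp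
    thus "mset (rev al) = mset (rev (mtilde P))" by (simp add: al_def mset_mtilde)
  qed
  show ?thesis
    using bij_betw_finite[OF bij] bij_betw_same_card[OF bij] count perm by (simp add: rho_def)
qed

section \<open>Shapes with a given number of filled cells and the final summation\<close>

definition outer_shapes :: "nat \<Rightarrow> nat list set" where
  "outer_shapes r = {la. is_partition la \<and> sum_list la = parts (tl la) 0 + r}"

text \<open>With \<open>la\<close> as the upper rows, the bottom row has \<open>parts la 0\<close>
  blank cells and \<open>r - sum_list la\<close> filled ones. If this length is 0 then
  \<open>la = []\<close>, and a zero row is invisible to \<open>parts\<close>.\<close>

lemma prepend_in_outer_shapes:
  assumes "is_partition la" "sum_list la \<le> r"
  shows "prepend (parts la 0 + (r - sum_list la)) la \<in> outer_shapes r"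
    "tl (prepend (parts la 0 + (r - sum_list la)) la) = la"
    "parts (prepend (parts la 0 + (r - sum_list la)) la) = parts ((parts la 0 + (r - sum_list la)) # la)"
proof -
  let ?k = "parts la 0 + (r - sum_list la)"
  have nil: "la = []" if "?k = 0"
  proof (cases la)
    case (Cons a l)
    hence "0 < a" using assms(1) by (simp add: is_partition_def)
    thus ?thesis using that Cons by simp
  qed
  show tl: "tl (prepend ?k la) = la"
  proof (cases "?k = 0")
    case True
    show ?thesis unfolding nil[OF True] by (simp add: prepend_def)
  qed (auto simp: prepend_def)
  show "parts (prepend ?k la) = parts (?k # la)"
  proof (cases "?k = 0")
    case True
    have "parts [] = parts [0]" by (auto simp: parts_def)
    thus ?thesis unfolding True unfolding nil[OF True] by (simp add: prepend_def)
  qed (auto simp: prepend_def)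
  have "sum_list (prepend ?k la) = parts la 0 + r" using assms(2) by (simp add: prepend_def)
  thus "prepend ?k la \<in> outer_shapes r"
    using tl prepend_partition[OF assms(1), of ?k] by (simp add: outer_shapes_def)
qed

lemma outer_shapes_tl:
  assumes "la \<in> outer_shapes r"
  shows "is_partition (tl la)" "sum_list (tl la) \<le> r"
    "prepend (parts (tl la) 0 + (r - sum_list (tl la))) (tl la) = la"
proof -
  have la: "is_partition la" "sum_list la = parts (tl la) 0 + r" using assms by (auto simp: outer_shapes_def)
  show "is_partition (tl la)" by (rule is_partition_tl[OF la(1)])
  have "parts (tl la) 0 \<le> parts la 0" using le_funD[OF row_le_parts[OF la(1)], of 0] by (simp add: row_def)
  thus le: "sum_list (tl la) \<le> r" using la(2) by (cases la) auto
  show "prepend (parts (tl la) 0 + (r - sum_list (tl la))) (tl la) = la"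
  proof (cases la)
    case Nil
    thus ?thesis using la by (simp add: prepend_def)
  next
    case (Cons a l)
    have "parts l 0 + (r - sum_list l) = a" using la(2) le Cons by simp
    moreover have "0 < a" using la(1) Cons by (simp add: is_partition_def)
    ultimately show ?thesis by (simp add: Cons prepend_def)
  qed
qed

lemma finite_outer_shapes: "finite (outer_shapes r)"
proof (rule finite_subset)
  show "outer_shapes r \<subseteq> (\<lambda>la. prepend (parts la 0 + (r - sum_list la)) la) ` {la. is_partition la \<and> sum_list la \<le> r}"
  proof
    fix la assume "la \<in> outer_shapes r"
    note t = outer_shapes_tl[OF this]
    show "la \<in> (\<lambda>la. prepend (parts la 0 + (r - sum_list la)) la) ` {la. is_partition la \<and> sum_list la \<le> r}"
      by (rule image_eqI[of _ _ "tl la"], rule t(3)[symmetric]) (simp add: t(1,2))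
  qed
qed (intro finite_imageI finite_partitions_le)

text \<open>The entries of a tableau form a multiset partition of its content, with as many blocks
  as there are filled cells; positivity of the letters is inherited from
  \<open>content mu\<close>.\<close>

lemma mtableaux_eq_Union:
  "mtableaux mu = (\<Union>P\<in>mset_partitions (content mu). SIGMA la:outer_shapes (size P). block_tableaux la P)"
proof (intro equalityI subsetI)
  fix x assume "x \<in> mtableaux mu"
  then obtain la T where x: "x = (la, T)" and T: "(la, T) \<in> mtableaux mu" by (cases x) auto
  define P where "P = image_mset T (mset_set (filled la))"
  have la: "is_partition la" using T by (simp add: mtableaux_def)
  have "sum_mset P = content mu" using T by (simp add: P_def mtableaux_def sum_unfold_sum_mset)
  moreover have "\<forall>B\<in>#P. B \<noteq> {#}" using T finite_filled[of la] by (auto simp: P_def mtableaux_def)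
  ultimately have "P \<in> mset_partitions (content mu)" by (simp add: mset_partitions_def)
  moreover have "la \<in> outer_shapes (size P)"
    using la card_filled[OF la] by (simp add: outer_shapes_def P_def)
  moreover have "T \<in> block_tableaux la P" using T by (simp add: block_tableaux_def P_def mtableaux_def)
  ultimately show "x \<in> (\<Union>P\<in>mset_partitions (content mu). SIGMA la:outer_shapes (size P). block_tableaux la P)"
    unfolding x by blast
next
  fix x assume "x \<in> (\<Union>P\<in>mset_partitions (content mu). SIGMA la:outer_shapes (size P). block_tableaux la P)"
  then obtain P la T where x: "x = (la, T)" and P: "P \<in> mset_partitions (content mu)"
    and la: "la \<in> outer_shapes (size P)" and T: "T \<in> block_tableaux la P" by blast
  have PT: "P = image_mset T (mset_set (filled la))" using T by (simp add: block_tableaux_def)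
  have TP: "T c \<in># P" if "c \<in> filled la" for c unfolding PT using that finite_filled by simp
  have "T c \<noteq> {#}" if "c \<in> filled la" for c using TP[OF that] P by (auto simp: mset_partitions_def)
  moreover have "0 < y" if "c \<in> filled la" "y \<in># T c" for c y
  proof -
    have "y \<in># sum_mset P" using TP[OF that(1)] that(2) by auto
    moreover have "sum_mset P = content mu" using P by (simp add: mset_partitions_def)
    ultimately have "y \<in># content mu" by (simp only:)
    thus ?thesis by (auto simp: set_mset_content)
  qed
  moreover have "(\<Sum>c\<in>filled la. T c) = content mu"
    using P unfolding PT by (simp add: mset_partitions_def sum_unfold_sum_mset)
  ultimately show "x \<in> mtableaux mu"
    using la T unfolding x mtableaux_def block_tableaux_def outer_shapes_def by simp
qed

text \<open>Removing the bottom row turns the outer shapes into the index set of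
  \<open>htilde_eq_sum_stilde\<close>, and the number of tableaux of each shape is the stable Kostka
  coefficient.\<close>

lemma sum_block_tableaux:
  assumes P: "{#} \<notin># P"
  shows "(\<Sum>(la, T)\<in>(SIGMA la:outer_shapes (size P). block_tableaux la P). stilde (tl la)) = htilde (mtilde P)"
proof -
  let ?r = "size P"
  let ?e = "\<lambda>la. prepend (parts la 0 + (?r - sum_list la)) la"
  have fin: "finite (block_tableaux la P)" if "la \<in> outer_shapes ?r" for la
    using block_tableaux_count[OF _ order_refl P, of la] that by (simp add: outer_shapes_def)
  have const: "(\<Sum>T\<in>A. f) = sscale (of_nat (card A)) f" for A :: "'t set" and f
    by (rule ext) (simp add: sum_fun_apply sscale_def)
  have "(\<Sum>(la, T)\<in>(SIGMA la:outer_shapes ?r. block_tableaux la P). stilde (tl la)) =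
      (\<Sum>la\<in>outer_shapes ?r. \<Sum>T\<in>block_tableaux la P. stilde (tl la))"
    using fin by (intro sum.Sigma[symmetric] finite_outer_shapes) auto
  also have "\<dots> = (\<Sum>la\<in>outer_shapes ?r. sscale (of_nat (card (block_tableaux la P))) (stilde (tl la)))"
    by (simp only: const)
  also have "\<dots> = (\<Sum>la\<in>{la. is_partition la \<and> sum_list la \<le> ?r}.
      sscale (of_nat (stable_kostka la (mtilde P))) (stilde la))"
  proof (rule sum.reindex_bij_witness[where i = ?e and j = tl])
    fix la assume la: "la \<in> outer_shapes ?r"
    note t = outer_shapes_tl[OF la]
    show "?e (tl la) = la" by (rule t(3))
    show "tl la \<in> {la. is_partition la \<and> sum_list la \<le> ?r}" using t by simp
    have "card (block_tableaux la P) =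
        strip_chains (Suc (length (tl la))) (row (parts (tl la) 0)) (parts la) (rev (mtilde P))"
      using block_tableaux_count[OF _ _ P, of la "Suc (length (tl la))"] la by (simp add: outer_shapes_def)
    also have "parts la = parts ((parts (tl la) 0 + (?r - sum_list (tl la))) # tl la)"
      using prepend_in_outer_shapes(3)[OF t(1,2)] unfolding t(3) .
    finally have "card (block_tableaux la P) = stable_kostka (tl la) (mtilde P)"
      by (simp add: stable_kostka_def sum_list_mtilde)
    thus "sscale (of_nat (stable_kostka (tl la) (mtilde P))) (stilde (tl la)) =
        sscale (of_nat (card (block_tableaux la P))) (stilde (tl la))" by simp
  qed (use prepend_in_outer_shapes(1,2) in blast)+
  also have "\<dots> = htilde (mtilde P)"
    using htilde_eq_sum_stilde[OF is_partition_mtilde[of P]] by (simp add: sum_list_mtilde)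
  finally show ?thesis .
qed

theorem theorem5:
  fixes mu :: "nat list"
  assumes "is_partition mu"
  shows "hbasis mu = (\<Sum>(la, T)\<in>mtableaux mu. stilde (tl la))"
proof -
  let ?M = "mset_partitions (content mu)"
  let ?X = "\<lambda>P. SIGMA la:outer_shapes (size P). block_tableaux la P"
  have ne: "{#} \<notin># P" if "P \<in> ?M" for P using that by (auto simp: mset_partitions_def)
  have fin: "finite (?X P)" if "P \<in> ?M" for P
    using block_tableaux_count[OF _ order_refl ne[OF that]]
    by (intro finite_SigmaI finite_outer_shapes) (auto simp: outer_shapes_def)
  \<comment> \<open>A tableau recovers \<open>P\<close> as the multiset of its entries, so the
    pieces for different \<open>P\<close> are disjoint.\<close>
  have "(\<Sum>(la, T)\<in>mtableaux mu. stilde (tl la)) = (\<Sum>P\<in>?M. \<Sum>(la, T)\<in>?X P. stilde (tl la))"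
    unfolding mtableaux_eq_Union
    by (rule sum.UNION_disjoint) (use finite_mset_partitions fin in \<open>auto simp: block_tableaux_def\<close>)
  also have "\<dots> = (\<Sum>P\<in>?M. htilde (mtilde P))"
    by (intro sum.cong refl sum_block_tableaux ne)
  also have "\<dots> = hbasis mu" by (rule hbasis_eq_sum_htilde[OF assms, symmetric])
  finally show ?thesis by simp
qed

end
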